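(* Fix $N\ge2$, $n\ge1$, $0<|q|<1$, generic $r>0$, $p=q^{2r}$, and $\lambda=(\lambda_1,\dots,\lambda_N)\in\mathbb{Z}_{\ge0}^N$ with $\lambda_1+\cdots+\lambda_N=n$. Let $\mathcal{I}_\lambda$ be the set of sequences $\mu=(\mu_1,\dots,\mu_n)\in\{1,\dots,N\}^n$ with $\#\{s:\mu_s=l\}=\lambda_l$ for all $l$ (equivalently partitions $I=(I_1,\dots,I_N)$ of $[1,n]$ with $I_l=\{s:\mu_s=l\}$), and write $v_I=v_{\mu_1}\otimes\cdots\otimes v_{\mu_n}$. Let $\widetilde S_i(P)$ be the operators described in the context. Define vectors $\xi_I$ ($I\in\mathcal{I}_\lambda$), which are $V^{\otimes n}$-valued functions of $(z,P)$, by $\xi_{I^{max}}=v_{I^{max}}$, where $I^{max}$ corresponds to the sequence $(N,\dots,N,N-1,\dots,N-1,\dots,1,\dots,1)$ with $\lambda_l$ entries equal to $l$, and $\xi_{s_i(I)}=\widetilde S_i(P)\xi_I$, where $s_i(I)$ corresponds to the sequence obtained by swapping $\mu_i$ and $\mu_{i+1}$. Write $\xi_I=\sum_{J\in\mathcal I_\lambda}X_{IJ}(z,P)\,v_J$. Then for all $I,J\in\mathcal{I}_\lambda$, $$X_{IJ}(z,P)=\widetilde W_J\big(v;u';P'\big)\Big|_{v^{(l)}_a=-u_{i^{(l)}_a}\ (1\le l\le N-1,\ 1\le a\le\lambda^{(l)}),\ u'_b=-u_b\ (1\le b\le n),\ P'_{a,b}=P_{a,b}+\lambda_a-\lambda_b},$$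 where $z_k=q^{2u_k}$, $I^{(l)}=I_1\cup\cdots\cup I_l=\{i^{(l)}_1<\cdots<i^{(l)}_{\lambda^{(l)}}\}$, $\lambda^{(l)}=\lambda_1+\cdots+\lambda_l$, and $\widetilde W_J$ is the elliptic weight function defined in the context.
   Context: Theta function and $R$-matrix: $[u]=q^{u^2/r-u}\Theta_p(q^{2u})$, $\Theta_p(z)=(z;p)_\infty(p/z;p)_\infty(p;p)_\infty$. Let $b(u,s)=\frac{[s+1][s-1][u]}{[s]^2[u+1]}$, $\bar b(u)=\frac{[u]}{[u+1]}$, $c(u,s)=\frac{[1][s+u]}{[s][u+1]}$, $\bar c(u,s)=\frac{[1][s-u]}{[s][u+1]}$. $V=\bigoplus_{\mu=1}^N\mathbb{C}v_\mu$, $E_{i,j}v_\mu=\delta_{j,\mu}v_i$; $P=(P_1,\dots,P_N)$ generic complex parameters, $P_{j,k}=P_j-P_k$. For $z=q^{2u}$, $\bar R(z,\Pi^* )=\sum_jE_{j,j}\otimes E_{j,j}+\sum_{j_1<j_2}\big(b(u,P_{j_1,j_2})E_{j_1,j_1}\otimes E_{j_2,j_2}+\bar b(u)E_{j_2,j_2}\otimes E_{j_1,j_1}+c(u,P_{j_1,j_2})E_{j_1,j_2}\otimes E_{j_2,j_1}+\bar c(u,P_{j_1,j_2})E_{j_2,j_1}\otimes E_{j_1,j_2}\big)$. Operators: on $V^{\otimes n}$-valued functions of $(z_1,\dots,z_n;P)$, $\widetilde S_i(P)=\mathcal P^{(i,i+1)}\bar R^{(i,i+1)}(z_i/z_{i+1},\Pi^*q^{2\sum_{j<i}h^{(j)}})s^z_i$: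 $s^z_i$ swaps the arguments $z_i,z_{i+1}$, $\mathcal P^{(i,i+1)}$ swaps tensor factors $i,i+1$, and $\bar R^{(i,i+1)}$ acts on factors $i,i+1$ with $u=u_i-u_{i+1}$, where on a basis vector $v_{\mu_1}\otimes\cdots\otimes v_{\mu_n}$ each $P_{a,b}$ in its coefficients is replaced by $P_{a,b}+\sum_{j=1}^{i-1}(\delta_{\mu_j,a}-\delta_{\mu_j,b})$; scalar coefficients in $(z,P)$ are left unchanged (so $\widetilde S_i(P)\sum_J f_J(z,P)v_J=\sum_J f_J(s_i z,P)\widetilde S_i(P)v_J$). These operators satisfy the braid and involution relations, and $\xi_I$ is defined by the stated recursion. Weight function: for $J\in\mathcal I_\lambda$ with sequence $(\nu_1,\dots,\nu_n)$, let $J^{(l)}=\{s:\nu_s\le l\}=\{j^{(l)}_1<\cdots<j^{(l)}_{\lambda^{(l)}}\}$ ($J^{(N)}=[1,n]$). Variables $v^{(l)}_a$ ($1\le l\le N-1$, $1\le a\le\lambda^{(l)}$) and $v^{(N)}_b=u'_b$ ($1\le b\le n$). For $s\in[1,n]$ and $\nu_s\le l$ set $C_{\nu_s,l+1}(s)=\#\{k>s:\nu_k=\nu_s\}-\#\{k>s:\nu_k=l+1\}$. Define $$\widetilde U_J=\prod_{l=1}^{N-1}\prod_{a=1}^{\lambda^{(l)}}\Bigg(\frac{[v^{(l+1)}_{b_0}-v^{(l)}_a+P'_{\nu_s,l+1}-C_{\nu_s,l+1}(s)]\,[1]}{[v^{(l+1)}_{b_0}-v^{(l)}_a+1]\,[P'_{\nu_s,l+1}-C_{\nu_s,l+1}(s)]}\prod_{\substack{1\le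 b\le\lambda^{(l+1)}\\ j^{(l+1)}_b>j^{(l)}_a}}\frac{[v^{(l+1)}_b-v^{(l)}_a]}{[v^{(l+1)}_b-v^{(l)}_a+1]}\prod_{b=a+1}^{\lambda^{(l)}}\frac{[v^{(l)}_a-v^{(l)}_b-1]}{[v^{(l)}_a-v^{(l)}_b]}\Bigg),$$ where in the factor for $(l,a)$, $s=j^{(l)}_a$ and $b_0$ is the index with $j^{(l+1)}_{b_0}=s$. Then $\widetilde W_J(v;u';P')=\sum_{\sigma_1\in\mathfrak S_{\lambda^{(1)}}}\cdots\sum_{\sigma_{N-1}\in\mathfrak S_{\lambda^{(N-1)}}}\widetilde U_J\big|_{v^{(l)}_a\mapsto v^{(l)}_{\sigma_l(a)}}$ (symmetrization over each level $l=1,\dots,N-1$ separately; the $v^{(N)}$ are not permuted). The $u_k$ are generic. *)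

theory Defs
  imports "HOL-Analysis.Analysis" "HOL-Combinatorics.Permutations" "HOL-Library.FuncSet"
begin

text \<open>Complex powers of q are taken w.r.t. a fixed logarithm lq of q (q = exp lq):
  q^x := exp (x * lq).\<close>
definition qpow :: "complex \<Rightarrow> complex \<Rightarrow> complex" where
  "qpow lq x = exp (x * lq)"

definition nome :: "complex \<Rightarrow> real \<Rightarrow> complex" where
  "nome lq r = qpow lq (2 * of_real r)"

definition qpoch_inf :: "complex \<Rightarrow> complex \<Rightarrow> complex" where
  "qpoch_inf z p = prodinf (\<lambda>k. 1 - z * p ^ k)"

definition theta :: "complex \<Rightarrow> complex \<Rightarrow> complex" where
  "theta p z = qpoch_inf z p * qpoch_inf (p / z) p * qpoch_inf p p"

definition brk :: "complex \<Rightarrow> real \<Rightarrow> complex \<Rightarrow> complex" where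
  "brk lq r u = qpow lq (u\<^sup>2 / of_real r - u) * theta (nome lq r) (qpow lq (2 * u))"

definition bw :: "complex \<Rightarrow> real \<Rightarrow> complex \<Rightarrow> complex \<Rightarrow> complex" where
  "bw lq r u s = brk lq r (s + 1) * brk lq r (s - 1) * brk lq r u / ((brk lq r s)\<^sup>2 * brk lq r (u + 1))"

definition bbar :: "complex \<Rightarrow> real \<Rightarrow> complex \<Rightarrow> complex" where
  "bbar lq r u = brk lq r u / brk lq r (u + 1)"

definition cw :: "complex \<Rightarrow> real \<Rightarrow> complex \<Rightarrow> complex \<Rightarrow> complex" where
  "cw lq r u s = brk lq r 1 * brk lq r (s + u) / (brk lq r s * brk lq r (u + 1))"

definition cbar :: "complex \<Rightarrow> real \<Rightarrow> complex \<Rightarrow> complex \<Rightarrow> complex" where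
  "cbar lq r u s = brk lq r 1 * brk lq r (s - u) / (brk lq r s * brk lq r (u + 1))"

text \<open>Sequences mu = (mu_1..mu_n) in {1..N}^n are functions on {1..n} (extensional).
  A vector in V^(tensor n) is its coefficient function on such sequences.
  Swapping the entries at positions i, i+1 (also used for arguments u_i, u_(i+1)).\<close>
definition swp :: "nat \<Rightarrow> (nat \<Rightarrow> 'a) \<Rightarrow> nat \<Rightarrow> 'a" where
  "swp i f = f(i := f (Suc i), Suc i := f i)"

definition seqs :: "nat \<Rightarrow> nat \<Rightarrow> (nat \<Rightarrow> nat) set" where
  "seqs N n = {1..n} \<rightarrow>\<^sub>E {1..N}"

definition Iset :: "nat \<Rightarrow> nat \<Rightarrow> (nat \<Rightarrow> nat) \<Rightarrow> (nat \<Rightarrow> nat) set" where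
  "Iset N n lam = {mu \<in> seqs N n. \<forall>l\<in>{1..N}. card {s\<in>{1..n}. mu s = l} = lam l}"

definition Imax :: "nat \<Rightarrow> nat \<Rightarrow> (nat \<Rightarrow> nat) \<Rightarrow> nat \<Rightarrow> nat" where
  "Imax N n lam = (\<lambda>s\<in>{1..n}. THE l. l \<in> {1..N} \<and>
       (\<Sum>k\<in>{l<..N}. lam k) < s \<and> s \<le> (\<Sum>k\<in>{l..N}. lam k))"

text \<open>Dynamical shift: P_x + #{j < i. mu_j = x}; then the shifted P_(a,b) is
  Pshift a - Pshift b = P_(a,b) + sum_(j<i) (delta(mu_j,a) - delta(mu_j,b)).\<close>
definition Pshift :: "(nat \<Rightarrow> complex) \<Rightarrow> (nat \<Rightarrow> nat) \<Rightarrow> nat \<Rightarrow> nat \<Rightarrow> complex" where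
  "Pshift P mu i x = P x + of_nat (card {j\<in>{1..<i}. mu j = x})"

text \<open>Coefficient of v_nu in P^(i,i+1) Rbar^(i,i+1)(z_i/z_(i+1), dyn. shifted P) v_mu,
  where u = u_i - u_(i+1).\<close>
definition Scoef :: "complex \<Rightarrow> real \<Rightarrow> (nat \<Rightarrow> complex) \<Rightarrow> nat \<Rightarrow> (nat \<Rightarrow> complex)
    \<Rightarrow> (nat \<Rightarrow> nat) \<Rightarrow> (nat \<Rightarrow> nat) \<Rightarrow> complex" where
  "Scoef lq r P i u mu nu =
    (let a = mu i; b = mu (Suc i); x = u i - u (Suc i);
         Pa = Pshift P mu i a; Pb = Pshift P mu i b in
     if a = b then (if nu = mu then 1 else 0)
     else if a < b then
       (if nu = swp i mu then bw lq r x (Pa - Pb) else 0)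
       + (if nu = mu then cbar lq r x (Pa - Pb) else 0)
     else
       (if nu = swp i mu then bbar lq r x else 0)
       + (if nu = mu then cw lq r x (Pb - Pa) else 0))"

text \<open>The operator S~_i(P) on V^(tensor n)-valued functions of u (z_k = q^(2 u_k)).\<close>
definition St :: "complex \<Rightarrow> real \<Rightarrow> (nat \<Rightarrow> complex) \<Rightarrow> nat \<Rightarrow> nat \<Rightarrow> nat
    \<Rightarrow> ((nat \<Rightarrow> complex) \<Rightarrow> (nat \<Rightarrow> nat) \<Rightarrow> complex)
    \<Rightarrow> (nat \<Rightarrow> complex) \<Rightarrow> (nat \<Rightarrow> nat) \<Rightarrow> complex" where
  "St lq r P N n i F = (\<lambda>u nu. \<Sum>mu\<in>seqs N n. F (swp i u) mu * Scoef lq r P i u mu nu)"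

definition genu :: "complex \<Rightarrow> real \<Rightarrow> nat \<Rightarrow> (nat \<Rightarrow> complex) \<Rightarrow> bool" where
  "genu lq r n u = (\<forall>k\<in>{1..n}. \<forall>l\<in>{1..n}. k \<noteq> l \<longrightarrow>
      (\<forall>m::int. brk lq r (u k - u l + of_int m) \<noteq> 0))"

definition lamc :: "(nat \<Rightarrow> nat) \<Rightarrow> nat \<Rightarrow> nat" where
  "lamc lam l = (\<Sum>k\<in>{1..l}. lam k)"

definition Jset :: "(nat \<Rightarrow> nat) \<Rightarrow> nat \<Rightarrow> nat \<Rightarrow> nat set" where
  "Jset nu n l = {s\<in>{1..n}. nu s \<le> l}"

definition jidx :: "(nat \<Rightarrow> nat) \<Rightarrow> nat \<Rightarrow> nat \<Rightarrow> nat \<Rightarrow> nat" where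
  "jidx nu n l a = sorted_list_of_set (Jset nu n l) ! (a - 1)"

definition Cnum :: "(nat \<Rightarrow> nat) \<Rightarrow> nat \<Rightarrow> nat \<Rightarrow> nat \<Rightarrow> int" where
  "Cnum nu n l s = int (card {k\<in>{s<..n}. nu k = nu s}) - int (card {k\<in>{s<..n}. nu k = Suc l})"

text \<open>U~_J in variables v l a = v^(l)_a (v N b = u'_b) and parameters P' (P'_(a,b) = P' a - P' b).\<close>
definition Utilde :: "complex \<Rightarrow> real \<Rightarrow> nat \<Rightarrow> nat \<Rightarrow> (nat \<Rightarrow> nat) \<Rightarrow> (nat \<Rightarrow> nat)
    \<Rightarrow> (nat \<Rightarrow> nat \<Rightarrow> complex) \<Rightarrow> (nat \<Rightarrow> complex) \<Rightarrow> complex" where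
  "Utilde lq r N n lam nu v P' =
    (\<Prod>l\<in>{1..N-1}. \<Prod>a\<in>{1..lamc lam l}.
      (let s = jidx nu n l a;
           b0 = (THE b. b \<in> {1..lamc lam (Suc l)} \<and> jidx nu n (Suc l) b = s);
           d = P' (nu s) - P' (Suc l) - of_int (Cnum nu n l s) in
       brk lq r (v (Suc l) b0 - v l a + d) * brk lq r 1
         / (brk lq r (v (Suc l) b0 - v l a + 1) * brk lq r d)
       * (\<Prod>b\<in>{b\<in>{1..lamc lam (Suc l)}. jidx nu n (Suc l) b > s}.
            brk lq r (v (Suc l) b - v l a) / brk lq r (v (Suc l) b - v l a + 1))
       * (\<Prod>b\<in>{a<..lamc lam l}.
            brk lq r (v l a - v l b - 1) / brk lq r (v l a - v l b))))"

definition Wtilde :: "complex \<Rightarrow> real \<Rightarrow> nat \<Rightarrow> nat \<Rightarrow> (nat \<Rightarrow> nat) \<Rightarrow> (nat \<Rightarrow> nat)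
    \<Rightarrow> (nat \<Rightarrow> nat \<Rightarrow> complex) \<Rightarrow> (nat \<Rightarrow> complex) \<Rightarrow> complex" where
  "Wtilde lq r N n lam nu v P' =
    (\<Sum>\<sigma>\<in>(\<Pi>\<^sub>E l\<in>{1..N-1}. {\<pi>. \<pi> permutes {1..lamc lam l}}).
       Utilde lq r N n lam nu (\<lambda>l a. if l \<in> {1..N-1} then v l (\<sigma> l a) else v l a) P')"

end

theory Submission
  imports Defs
begin

text \<open>
  The bracket is a multiple of the Gaussian sum
  \<open>\<Sum>j. (- 1)^j q^((u + r (j - 1/2))^2 / r)\<close> (Jacobi triple product). Splitting a product of two such
  sums by the parity of \<open>i + j\<close> gives \<open>[u + x][u - x] = A(u) B(x) - B(u) A(x)\<close>, whose Pluecker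
  relation is the Weierstrass three-term identity; all theta identities below are instances of it.

  The specialized weight function is a nested sum: at level \<open>l\<close> one sums over all bijections from the
  positions of colour \<open>\<le> l\<close> in \<open>J\<close> onto the values \<open>- u_i\<close> with \<open>I_i \<le> l\<close>. It depends on \<open>I\<close> only through
  these sets of values, so the recursion for \<open>\<xi>\<close> becomes an exchange relation for two adjacent
  positions of \<open>J\<close>. That relation follows by induction on the level, where pairing each bijection with
  its transpose reduces the step to identities in two pairs of variables. For the initial sequence only
  the identical bijections contribute, because a factor \<open>[0]\<close> kills all others.
\<close>

section \<open>Gaussian sums over the integers and the q-binomial theorem\<close>

lemma summable_on_exp_neg_abs_int: "(\<lambda>j::int. exp (- \<bar>real_of_int j\<bar>)) summable_on UNIV"
proof -
  have geo: "(\<lambda>n::nat. exp (- real n)) summable_on UNIV"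
  proof (rule norm_summable_imp_summable_on)
    have "summable (\<lambda>n. (exp (-1) :: real) ^ n)"
      by (rule summable_geometric) simp
    also have "(\<lambda>n. (exp (-1) :: real) ^ n) = (\<lambda>n. norm (exp (- real n)))"
      by (simp add: exp_of_nat_mult[symmetric])
    finally show "summable (\<lambda>n. norm (exp (- real n)))" .
  qed
  have 1: "(\<lambda>j::int. exp (- \<bar>real_of_int j\<bar>)) summable_on range int"
    using geo by (subst summable_on_reindex) (auto simp: o_def)
  have 2: "(\<lambda>j::int. exp (- \<bar>real_of_int j\<bar>)) summable_on range (\<lambda>n. - int n)"
    using geo by (subst summable_on_reindex) (auto simp: o_def inj_on_def)
  have "range int \<union> range (\<lambda>n. - int n) = UNIV"
    by (auto simp: image_iff) (metis int_cases2)
  then show ?thesis using summable_on_union[OF 1 2] by simp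
qed

lemma summable_on_gaussian_int:
  fixes b c :: real
  assumes "c > 0"
  shows "(\<lambda>j::int. exp (b * real_of_int j - c * (real_of_int j)\<^sup>2)) summable_on UNIV"
proof (rule summable_on_comparison_test)
  define K where "K = exp ((\<bar>b\<bar> + 1)\<^sup>2 / (4 * c))"
  show "(\<lambda>j::int. K * exp (- \<bar>real_of_int j\<bar>)) summable_on UNIV"
    by (intro summable_on_cmult_right summable_on_exp_neg_abs_int)
  fix j :: int
  define x where "x = \<bar>real_of_int j\<bar>"
  have "b * real_of_int j \<le> \<bar>b\<bar> * x"
    unfolding x_def by (metis abs_ge_self abs_mult)
  moreover have "(real_of_int j)\<^sup>2 = x\<^sup>2" by (simp add: x_def)
  moreover have "0 \<le> (2 * c * x - (\<bar>b\<bar> + 1))\<^sup>2 / (4 * c)" using assms by simp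
  then have "0 \<le> c * x\<^sup>2 - (\<bar>b\<bar> + 1) * x + (\<bar>b\<bar> + 1)\<^sup>2 / (4 * c)"
    using assms by (simp add: field_simps power2_eq_square)
  ultimately have "b * real_of_int j - c * (real_of_int j)\<^sup>2 \<le> (\<bar>b\<bar> + 1)\<^sup>2 / (4 * c) + - x"
    by (simp add: algebra_simps)
  then show "exp (b * real_of_int j - c * (real_of_int j)\<^sup>2) \<le> K * exp (- \<bar>real_of_int j\<bar>)"
    unfolding K_def x_def by (simp add: mult_exp_exp)
qed auto

definition qfact :: "complex \<Rightarrow> nat \<Rightarrow> complex" where
  "qfact p m = (\<Prod>i<m. 1 - p ^ Suc i)"

definition qbin :: "complex \<Rightarrow> nat \<Rightarrow> nat \<Rightarrow> complex" where
  "qbin p m k = (if k \<le> m then qfact p m / (qfact p k * qfact p (m - k)) else 0)"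

lemma one_minus_pow_nz: "norm (p :: complex) < 1 \<Longrightarrow> 1 - p ^ Suc i \<noteq> 0"
proof
  assume p: "norm p < 1" and "1 - p ^ Suc i = 0"
  then have "norm p ^ Suc i = 1" by (metis eq_iff_diff_eq_0 norm_one norm_power)
  moreover have "norm p ^ Suc i < 1" using p by (metis norm_ge_zero power_Suc_less_one power_less_one_iff zero_less_Suc)
  ultimately show False by simp
qed

lemma qfact_nz: "norm p < 1 \<Longrightarrow> qfact p m \<noteq> 0"
  unfolding qfact_def by (simp only: prod_zero_iff finite_lessThan) (metis one_minus_pow_nz)

lemma qfact_Suc: "qfact p (Suc m) = qfact p m * (1 - p ^ Suc m)"
  by (simp add: qfact_def)

lemma qbin_0: "norm p < 1 \<Longrightarrow> qbin p m 0 = 1"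
  using qfact_nz[of p m] by (simp add: qbin_def) (simp add: qfact_def)

lemma qbin_Suc_Suc:
  assumes "norm p < 1"
  shows "qbin p (Suc m) (Suc k) = qbin p m (Suc k) + p ^ (m - k) * qbin p m k"
proof -
  consider "k < m" | "k = m" | "k > m" by linarith
  then show ?thesis
  proof cases
    case 1
    then obtain d where m: "m = Suc (k + d)" by (metis less_iff_Suc_add)
    have nz: "qfact p k \<noteq> 0" "qfact p d \<noteq> 0" "1 - p ^ Suc k \<noteq> 0" "1 - p ^ Suc d \<noteq> 0"
      using assms by (auto simp only: qfact_nz one_minus_pow_nz)
    have e: "1 - p ^ Suc m = (1 - p ^ Suc d) + p ^ Suc d * (1 - p ^ Suc k)"
      by (simp add: m algebra_simps power_add)
    define X Y where "X = 1 - p ^ Suc d" and "Y = 1 - p ^ Suc k"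
    have s: "Suc m - Suc k = Suc d" "m - Suc k = d" "m - k = Suc d" "k \<le> m" "Suc k \<le> m" "Suc k \<le> Suc m"
      using m by auto
    show ?thesis
      unfolding qbin_def if_P[OF s(4)] if_P[OF s(5)] if_P[OF s(6)] s(1-3) qfact_Suc[of p m] qfact_Suc[of p k]
        qfact_Suc[of p d] e
      using nz unfolding X_def[symmetric] Y_def[symmetric] by (simp add: field_simps)
  next
    case 2
    then show ?thesis using assms qfact_nz[of p "Suc m"] qfact_nz[of p m]
      by (simp add: qbin_def qfact_def)
  qed (simp add: qbin_def)
qed

lemma q_binomial_theorem:
  assumes "norm p < 1"
  shows "(\<Prod>k<m. 1 - x * p ^ k) = (\<Sum>k\<le>m. (-1) ^ k * p ^ (k choose 2) * qbin p m k * x ^ k)"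
proof (induction m)
  case 0
  then show ?case using qbin_0[OF assms] by (simp add: numeral_2_eq_2)
next
  case (Suc m)
  let ?c = "\<lambda>m k. (-1) ^ k * p ^ (k choose 2) * qbin p m k * x ^ k"
  have "(\<Sum>k\<le>Suc m. ?c (Suc m) k) = ?c (Suc m) 0 + (\<Sum>k\<le>m. ?c (Suc m) (Suc k))"
    by (rule sum.atMost_Suc_shift)
  also have "\<dots> = ?c m 0 + (\<Sum>k\<le>m. ?c m (Suc k) - x * p ^ m * ?c m k)"
  proof -
    have "?c (Suc m) (Suc k) = ?c m (Suc k) - x * p ^ m * ?c m k" if "k \<le> m" for k
    proof -
      have "Suc k choose 2 = k + (k choose 2)" by (simp add: numeral_2_eq_2)
      moreover have "p ^ m = p ^ k * p ^ (m - k)" using that by (simp add: power_add[symmetric])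
      ultimately show ?thesis
        using qbin_Suc_Suc[OF assms, of m k] by (simp add: algebra_simps power_add)
    qed
    then show ?thesis using qbin_0[OF assms] by simp
  qed
  also have "\<dots> = ?c m 0 + (\<Sum>k\<le>m. ?c m (Suc k)) - x * p ^ m * (\<Sum>k\<le>m. ?c m k)"
    by (simp add: sum_subtractf sum_distrib_left)
  also have "?c m 0 + (\<Sum>k\<le>m. ?c m (Suc k)) = (\<Sum>k\<le>Suc m. ?c m k)"
    by (rule sum.atMost_Suc_shift[symmetric])
  also have "\<dots> = (\<Sum>k\<le>m. ?c m k)" by (simp add: qbin_def)
  finally show ?case using Suc by (simp add: algebra_simps)
qed

section \<open>The Jacobi triple product\<close>

definition theta_term :: "complex \<Rightarrow> complex \<Rightarrow> int \<Rightarrow> complex" where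
  "theta_term R w j = (if even j then 1 else - 1) * exp (R * of_int (j * (j - 1)) + w * of_int j)"

lemma prod_lessThan_add: "(\<Prod>k<n + m. f k) = (\<Prod>k<n. f k) * (\<Prod>k<m. f (n + k :: nat) :: complex)"
  by (induction m) (simp_all add: mult.assoc)

lemma two_mult_of_nat_choose_two: "2 * R * of_nat (k choose 2) = (R * (of_nat k * (of_nat k - 1)) :: complex)"
  by (induction k) (simp_all add: numeral_2_eq_2 algebra_simps)

lemma finite_triple_product:
  fixes R w :: complex
  defines "p \<equiv> exp (2 * R)"
  assumes p: "norm p < 1"
  shows "(\<Prod>k<n. 1 - exp w * p ^ k) * (\<Prod>k<n. 1 - p / exp w * p ^ k) =
         (\<Sum>j\<in>{- int n..int n}. qbin p (2 * n) (nat (int n + j)) * theta_term R w j)"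
proof -
  define x where "x = exp (w - 2 * R * of_nat n)"
  have pk: "p ^ k = exp (2 * R * of_nat k)" for k
    unfolding p_def by (simp add: exp_of_nat2_mult)
  have xk: "x ^ k = exp ((w - 2 * R * of_nat n) * of_nat k)" for k
    unfolding x_def by (simp add: exp_of_nat2_mult)
  have "(\<Prod>k<n. 1 - x * p ^ k) = (\<Prod>k<n. 1 - x * p ^ (n - Suc k))"
    by (rule prod.nat_diff_reindex[symmetric])
  also have "\<dots> = (\<Prod>k<n. - exp (w - 2 * R * of_nat (Suc k)) * (1 - p / exp w * p ^ k))"
  proof (rule prod.cong[OF refl])
    fix k assume "k \<in> {..<n}"
    then have "Suc k \<le> n" by auto
    then have "x * p ^ (n - Suc k) = exp (w - 2 * R * of_nat (Suc k))"
      unfolding pk x_def by (simp add: mult_exp_exp of_nat_diff algebra_simps)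
    moreover have "exp (w - 2 * R * of_nat (Suc k)) * (p / exp w * p ^ k) = 1"
      unfolding pk unfolding p_def by (simp only: mult_exp_exp exp_diff[symmetric]) (simp add: algebra_simps)
    ultimately show "1 - x * p ^ (n - Suc k) = - exp (w - 2 * R * of_nat (Suc k)) * (1 - p / exp w * p ^ k)"
      by (simp add: algebra_simps)
  qed
  also have "\<dots> = (\<Prod>k<n. - exp (w - 2 * R * of_nat (Suc k))) * (\<Prod>k<n. 1 - p / exp w * p ^ k)"
    by (rule prod.distrib)
  also have "(\<Prod>k<n. - exp (w - 2 * R * of_nat (Suc k))) =
      (-1) ^ n * exp (of_nat n * w - R * of_nat n * of_nat (Suc n))"
    by (induction n) (simp_all add: mult_exp_exp algebra_simps)
  finally have first: "(\<Prod>k<n. 1 - x * p ^ k) =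
      (-1) ^ n * exp (of_nat n * w - R * of_nat n * of_nat (Suc n)) * (\<Prod>k<n. 1 - p / exp w * p ^ k)" .
  have "(\<Prod>k<n. 1 - x * p ^ (n + k)) = (\<Prod>k<n. 1 - exp w * p ^ k)"
    by (intro prod.cong refl) (simp add: pk x_def mult_exp_exp algebra_simps)
  with first have X: "(\<Prod>k<n + n. 1 - x * p ^ k) = (-1) ^ n * exp (of_nat n * w - R * of_nat n * of_nat (Suc n)) *
      ((\<Prod>k<n. 1 - exp w * p ^ k) * (\<Prod>k<n. 1 - p / exp w * p ^ k))"
    by (simp add: prod_lessThan_add mult_ac)
  have "(\<Prod>k<n. 1 - exp w * p ^ k) * (\<Prod>k<n. 1 - p / exp w * p ^ k) =
      (-1) ^ n * exp (- (of_nat n * w - R * of_nat n * of_nat (Suc n))) * (\<Prod>k<n + n. 1 - x * p ^ k)"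
  proof -
    have cancel: "F = s * e' * X" if "X = s * e * F" "s * s = 1" "e' * e = 1" for s e e' X F :: complex
      using that by algebra
    show ?thesis
      by (rule cancel[OF X]) (simp_all add: power_mult_distrib[symmetric] mult_exp_exp)
  qed
  also have "\<dots> = (\<Sum>k\<le>2 * n. (-1) ^ n * exp (- (of_nat n * w - R * of_nat n * of_nat (Suc n))) *
      ((-1) ^ k * p ^ (k choose 2) * qbin p (2 * n) k * x ^ k))"
    unfolding mult_2 q_binomial_theorem[OF p] sum_distrib_left ..
  also have "\<dots> = (\<Sum>j\<in>{- int n..int n}. qbin p (2 * n) (nat (int n + j)) * theta_term R w j)"
  proof (rule sum.reindex_bij_witness[of _ "\<lambda>j. nat (int n + j)" "\<lambda>k. int k - int n"])
    fix k assume "k \<in> {..2 * n}"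
    have "(-1) ^ n * exp (- (of_nat n * w - R * of_nat n * of_nat (Suc n))) *
        ((-1) ^ k * p ^ (k choose 2) * qbin p (2 * n) k * x ^ k) =
      ((-1) ^ (n + k)) * qbin p (2 * n) k * (exp (- (of_nat n * w - R * of_nat n * of_nat (Suc n))) *
        exp (2 * R * of_nat (k choose 2)) * exp ((w - 2 * R * of_nat n) * of_nat k))"
      by (simp add: pk xk power_add)
    also have "exp (- (of_nat n * w - R * of_nat n * of_nat (Suc n))) *
        exp (2 * R * of_nat (k choose 2)) * exp ((w - 2 * R * of_nat n) * of_nat k) =
      exp (R * of_int ((int k - int n) * (int k - int n - 1)) + w * of_int (int k - int n))"
      unfolding two_mult_of_nat_choose_two by (simp add: mult_exp_exp algebra_simps)
    also have "(-1 :: complex) ^ (n + k) = (if even (int k - int n) then 1 else - 1)"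
      by auto
    finally have fin: "(-1) ^ n * exp (- (of_nat n * w - R * of_nat n * of_nat (Suc n))) *
        ((-1) ^ k * p ^ (k choose 2) * qbin p (2 * n) k * x ^ k) = (if even (int k - int n) then 1 else - 1) *
        qbin p (2 * n) k *
        exp (R * of_int ((int k - int n) * (int k - int n - 1)) + w * of_int (int k - int n))" .
    show "qbin p (2 * n) (nat (int n + (int k - int n))) * theta_term R w (int k - int n) =
        (-1) ^ n * exp (- (of_nat n * w - R * of_nat n * of_nat (Suc n))) *
        ((-1) ^ k * p ^ (k choose 2) * qbin p (2 * n) k * x ^ k)"
      unfolding fin theta_term_def by simp
  qed auto
  finally show ?thesis .
qed

lemma convergent_prod_one_minus_geometric:
  fixes x p :: complex
  assumes "norm p < 1"
  shows "convergent_prod (\<lambda>k. 1 - x * p ^ k)"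
proof (intro abs_convergent_prod_imp_convergent_prod summable_imp_abs_convergent_prod)
  show "summable (\<lambda>k. norm (1 - x * p ^ k - 1))"
    using assms by (simp add: norm_mult norm_power summable_mult summable_geometric)
qed

lemma qpoch_inf_LIMSEQ:
  assumes "norm p < 1"
  shows "(\<lambda>n. \<Prod>k<n. 1 - x * p ^ k) \<longlonglongrightarrow> qpoch_inf x p"
  using convergent_prod_LIMSEQ[OF convergent_prod_one_minus_geometric[OF assms]]
  unfolding qpoch_inf_def LIMSEQ_lessThan_iff_atMost .

lemma qfact_LIMSEQ: "norm p < 1 \<Longrightarrow> qfact p \<longlonglongrightarrow> qpoch_inf p p"
  using qpoch_inf_LIMSEQ[of p p] by (simp add: qfact_def[abs_def])

lemma qpoch_inf_self_nz: 
  assumes "norm p < 1"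
  shows "qpoch_inf p p \<noteq> 0"
  unfolding qpoch_inf_def
  using one_minus_pow_nz[OF assms] by (intro prodinf_nonzero convergent_prod_one_minus_geometric assms) simp

lemma qbin_bounded:
  assumes "norm p < 1"
  obtains M where "\<And>m k. norm (qbin p m k) \<le> M"
proof -
  obtain B where B: "\<And>m. norm (qfact p m) \<le> B"
    using convergent_imp_Bseq[OF convergentI[OF qfact_LIMSEQ[OF assms]]] by (auto simp: Bseq_def)
  have "(\<lambda>m. inverse (qfact p m)) \<longlonglongrightarrow> inverse (qpoch_inf p p)"
    using qfact_LIMSEQ[OF assms] qpoch_inf_self_nz[OF assms] by (rule tendsto_inverse)
  then have "Bseq (\<lambda>m. inverse (qfact p m))"
    by (intro convergent_imp_Bseq convergentI)
  then obtain C where C: "\<And>m. norm (inverse (qfact p m)) \<le> C"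
    by (auto simp: Bseq_def)
  have BC: "B \<ge> 0" "C \<ge> 0" using B[of 0] C[of 0] norm_ge_zero order_trans by blast+
  have "norm (qbin p m k) \<le> B * (C * C)" for m k
  proof (cases "k \<le> m")
    case True
    then have "qbin p m k = qfact p m * (inverse (qfact p k) * inverse (qfact p (m - k)))"
      by (simp add: qbin_def field_simps)
    then show ?thesis
      using B C BC by (simp add: norm_mult mult_mono del: norm_inverse)
  qed (use BC in \<open>simp add: qbin_def\<close>)
  then show ?thesis by (rule that)
qed

lemma qbin_central_LIMSEQ:
  assumes "norm p < 1"
  shows "(\<lambda>n. qbin p (2 * n) (nat (int n + j))) \<longlonglongrightarrow> 1 / qpoch_inf p p"
proof -
  let ?Q = "qpoch_inf p p"
  have Q: "?Q \<noteq> 0" by (rule qpoch_inf_self_nz[OF assms])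
  have 1: "filterlim (\<lambda>n. 2 * n :: nat) sequentially sequentially"
    by (rule filterlim_subseq) (simp add: strict_mono_def)
  have shift: "filterlim (\<lambda>n. nat (int n + i)) sequentially sequentially" for i
  proof (rule filterlim_at_top_mono)
    show "filterlim (\<lambda>n. n - nat \<bar>i\<bar>) sequentially sequentially"
      by (rule filterlim_minus_const_nat_at_top)
    show "\<forall>\<^sub>F n in sequentially. n - nat \<bar>i\<bar> \<le> nat (int n + i)"
      by (rule always_eventually) auto
  qed
  have "(\<lambda>n. qfact p (2 * n) / (qfact p (nat (int n + j)) * qfact p (nat (int n + - j)))) \<longlonglongrightarrow> ?Q / (?Q * ?Q)"
    using Q by (intro tendsto_intros filterlim_compose[OF qfact_LIMSEQ[OF assms]] 1 shift) auto
  moreover have "\<forall>\<^sub>F n in sequentially. qfact p (2 * n) / (qfact p (nat (int n + j)) * qfact p (nat (int n + - j)))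
      = qbin p (2 * n) (nat (int n + j))"
    using eventually_ge_at_top[of "nat \<bar>j\<bar>"]
  proof eventually_elim
    case (elim n)
    then have "nat (int n + j) \<le> 2 * n" "2 * n - nat (int n + j) = nat (int n + - j)" by auto
    then show ?case by (simp add: qbin_def)
  qed
  ultimately show ?thesis using Q by (simp add: tendsto_cong)
qed

lemma abs_summable_theta_term:
  assumes "Re R < 0"
  shows "(\<lambda>j. norm (theta_term R w j)) summable_on UNIV"
proof -
  have "norm (theta_term R w j) = exp (Re (w - R) * real_of_int j - (- Re R) * (real_of_int j)\<^sup>2)" for j
    by (simp add: theta_term_def norm_mult power2_eq_square algebra_simps)
  then show ?thesis using summable_on_gaussian_int[of "- Re R" "Re (w - R)"] assms by simp
qed

theorem theta_series:
  assumes "Re R < 0"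
  shows "theta (exp (2 * R)) (exp w) = (\<Sum>\<^sub>\<infinity>j\<in>UNIV. theta_term R w j)"
proof -
  define p where "p = exp (2 * R)"
  have p: "norm p < 1" using assms by (simp add: p_def)
  let ?Q = "qpoch_inf p p"
  have Q: "?Q \<noteq> 0" by (rule qpoch_inf_self_nz[OF p])
  obtain M where M: "\<And>m k. norm (qbin p m k) \<le> M" using qbin_bounded[OF p] by blast
  have M0: "M \<ge> 0" using M[of 0 0] norm_ge_zero order_trans by blast
  define a where "a k n = (if \<bar>int_decode k\<bar> \<le> int n
      then qbin p (2 * n) (nat (int n + int_decode k)) * theta_term R w (int_decode k) else 0)" for k n
  have bij: "bij_betw int_decode UNIV UNIV" by (rule bij_int_decode)
  have abs: "(\<lambda>k. norm (theta_term R w (int_decode k))) summable_on UNIV"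
    using abs_summable_theta_term[OF assms, of w]
    by (subst summable_on_reindex_bij_betw[OF bij])
  have "suminf (\<lambda>k. a k n) = (\<Prod>k<n. 1 - exp w * p ^ k) * (\<Prod>k<n. 1 - p / exp w * p ^ k)" for n
  proof -
    have "suminf (\<lambda>k. a k n) = (\<Sum>k\<in>int_encode ` {- int n..int n}. a k n)"
    proof (rule suminf_finite)
      fix k assume "k \<notin> int_encode ` {- int n..int n}"
      then have "int_decode k \<notin> {- int n..int n}" by (metis image_eqI int_decode_inverse)
      then show "a k n = 0" by (auto simp: a_def)
    qed simp
    also have "\<dots> = (\<Sum>j\<in>{- int n..int n}. a (int_encode j) n)"
      by (subst sum.reindex) (simp_all add: inj_int_encode o_def)
    also have "\<dots> = (\<Sum>j\<in>{- int n..int n}. qbin p (2 * n) (nat (int n + j)) * theta_term R w j)"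
      by (intro sum.cong) (auto simp: a_def)
    finally show ?thesis using finite_triple_product[of R w n] p by (simp add: p_def)
  qed
  moreover have "(\<lambda>n. suminf (\<lambda>k. a k n)) \<longlonglongrightarrow> suminf (\<lambda>k. 1 / ?Q * theta_term R w (int_decode k))"
  proof (rule tannerys_theorem[THEN conjunct2, THEN conjunct2])
    show "(\<lambda>n. a k n) \<longlonglongrightarrow> 1 / ?Q * theta_term R w (int_decode k)" for k
    proof (rule Lim_transform_eventually)
      show "(\<lambda>n. qbin p (2 * n) (nat (int n + int_decode k)) * theta_term R w (int_decode k))
          \<longlonglongrightarrow> 1 / ?Q * theta_term R w (int_decode k)"
        by (intro tendsto_mult qbin_central_LIMSEQ p tendsto_const)
      show "\<forall>\<^sub>F n in sequentially. qbin p (2 * n) (nat (int n + int_decode k)) * theta_term R w (int_decode k) = a k n"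
        using eventually_ge_at_top[of "nat \<bar>int_decode k\<bar>"] by eventually_elim (auto simp: a_def)
    qed
    show "\<forall>\<^sub>F (k, n) in at_top \<times>\<^sub>F sequentially. norm (a k n) \<le> M * norm (theta_term R w (int_decode k))"
      using M M0 by (intro always_eventually) (auto simp: a_def norm_mult intro!: mult_right_mono)
    show "summable (\<lambda>k. M * norm (theta_term R w (int_decode k)))"
      by (intro summable_mult summable_on_imp_summable abs)
  qed simp
  ultimately have "(\<lambda>n. (\<Prod>k<n. 1 - exp w * p ^ k) * (\<Prod>k<n. 1 - p / exp w * p ^ k))
      \<longlonglongrightarrow> suminf (\<lambda>k. 1 / ?Q * theta_term R w (int_decode k))" by simp
  moreover have "(\<lambda>n. (\<Prod>k<n. 1 - exp w * p ^ k) * (\<Prod>k<n. 1 - p / exp w * p ^ k))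
      \<longlonglongrightarrow> qpoch_inf (exp w) p * qpoch_inf (p / exp w) p"
    by (intro tendsto_mult qpoch_inf_LIMSEQ p)
  ultimately have "qpoch_inf (exp w) p * qpoch_inf (p / exp w) p = suminf (\<lambda>k. 1 / ?Q * theta_term R w (int_decode k))"
    using LIMSEQ_unique by blast
  also have "\<dots> = 1 / ?Q * suminf (\<lambda>k. theta_term R w (int_decode k))"
    by (rule suminf_mult[OF summable_norm_cancel[OF summable_on_imp_summable[OF abs]]])
  also have "suminf (\<lambda>k. theta_term R w (int_decode k)) = (\<Sum>\<^sub>\<infinity>k\<in>UNIV. theta_term R w (int_decode k))"
    using has_sum_imp_sums[OF has_sum_infsum[OF abs_summable_summable[OF abs]]] by (rule sums_unique[symmetric])
  also have "\<dots> = (\<Sum>\<^sub>\<infinity>j\<in>UNIV. theta_term R w j)"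
    by (rule infsum_reindex_bij_betw[OF bij])
  finally show ?thesis using Q by (simp add: theta_def p_def)
qed

section \<open>Product formula for the bracket\<close>

lemma has_sum_product:
  fixes f :: "'a \<Rightarrow> complex" and g :: "'b \<Rightarrow> complex"
  assumes f: "(\<lambda>i. norm (f i)) summable_on UNIV" and g: "(\<lambda>j. norm (g j)) summable_on UNIV"
  shows "((\<lambda>(i, j). f i * g j) has_sum infsum f UNIV * infsum g UNIV) UNIV"
proof -
  have fs: "f summable_on UNIV" and gs: "g summable_on UNIV"
    using f g by (simp_all add: abs_summable_summable)
  have "(\<lambda>x. norm (case x of (i, j) \<Rightarrow> f i * g j)) summable_on UNIV \<times> UNIV"
    using f g
    by (intro Infinite_Sum.abs_summable_on_Sigma_iff[THEN iffD2])
       (simp_all add: norm_mult summable_on_cmult_right infsum_cmult_right' infsum_nonneg summable_on_cmult_left)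
  then have "(\<lambda>(i, j). f i * g j) summable_on UNIV \<times> UNIV"
    by (rule abs_summable_summable)
  then have "((\<lambda>(i, j). f i * g j) has_sum infsum f UNIV * infsum g UNIV) (UNIV \<times> UNIV)"
    using fs gs
    by (intro has_sum_SigmaI[where g = "\<lambda>i. f i * infsum g UNIV"])
       (auto intro!: has_sum_cmult_right has_sum_cmult_left has_sum_infsum)
  then show ?thesis by simp
qed

lemma abs_summable_on_gaussian:
  fixes c x :: complex and r h :: real
  assumes "Re (c * of_real (r\<^sup>2)) < 0"
  shows "(\<lambda>j::int. norm (exp (c * (x + of_real (r * (of_int j + h)))\<^sup>2))) summable_on UNIV"
proof -
  define y where "y = x + of_real (r * h)"
  have e: "c * (x + of_real (r * (of_int j + h)))\<^sup>2 =
      c * of_real (r\<^sup>2) * of_real ((of_int j)\<^sup>2) + (2 * c * of_real r * y) * of_real (of_int j) + c * y\<^sup>2" for j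
    unfolding y_def by (simp add: power2_eq_square algebra_simps)
  have "norm (exp (c * (x + of_real (r * (of_int j + h)))\<^sup>2)) = exp (Re (c * y\<^sup>2)) *
      exp (Re (2 * c * of_real r * y) * of_int j - (- Re (c * of_real (r\<^sup>2))) * (of_int j)\<^sup>2)" for j
    unfolding e norm_exp_eq_Re plus_complex.sel by (simp only: Re_complex_of_real Im_complex_of_real times_complex.sel mult_exp_exp) (simp add: algebra_simps)
  then show ?thesis
    using summable_on_gaussian_int[of "- Re (c * of_real (r\<^sup>2))" "Re (2 * c * of_real r * y)"] assms
    by (simp add: summable_on_cmult_right del: times_complex.sel)
qed

definition theta0 :: "complex \<Rightarrow> real \<Rightarrow> real \<Rightarrow> complex \<Rightarrow> complex" where
  "theta0 c r h x = (\<Sum>\<^sub>\<infinity>j\<in>UNIV. exp (c * (x + of_real (r * (real_of_int j + h)))\<^sup>2))"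

context
  fixes lq :: complex and r :: real
  assumes lq: "Re lq < 0" and r: "r > 0"
begin

definition brk_term :: "complex \<Rightarrow> int \<Rightarrow> complex" where
  "brk_term u j = (if even j then 1 else - 1) * exp (lq / of_real r * (u + of_real (r * (real_of_int j + - 1 / 2)))\<^sup>2)"

lemma Re_neg: "Re (lq / of_real r * of_real (r\<^sup>2)) < 0" "Re (2 * lq / of_real r * of_real (r\<^sup>2)) < 0"
proof -
  have "lq / of_real r * of_real (r\<^sup>2) = of_real r * lq" "2 * lq / of_real r * of_real (r\<^sup>2) = of_real (2 * r) * lq"
    using r by (simp_all add: power2_eq_square)
  then show "Re (lq / of_real r * of_real (r\<^sup>2)) < 0" "Re (2 * lq / of_real r * of_real (r\<^sup>2)) < 0"
    using lq r by (simp_all add: mult_pos_neg)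
qed

lemma abs_summable_brk_term: "(\<lambda>j. norm (brk_term u j)) summable_on UNIV"
proof -
  have "norm (brk_term u j) = norm (exp (lq / of_real r * (u + of_real (r * (real_of_int j + - 1 / 2)))\<^sup>2))" for j
    unfolding brk_term_def norm_mult by simp
  then show ?thesis
    using abs_summable_on_gaussian[OF Re_neg(1), of u "- 1 / 2"] by (simp only:)
qed

lemma brk_series: "brk lq r u = exp (- lq * of_real r / 4) * (\<Sum>\<^sub>\<infinity>j\<in>UNIV. brk_term u j)"
proof -
  have neg: "Re (lq * of_real r) < 0" using lq r by (simp add: mult_neg_pos)
  have "brk lq r u = exp ((u\<^sup>2 / of_real r - u) * lq) * theta (exp (2 * (lq * of_real r))) (exp (2 * u * lq))"
    by (simp add: brk_def qpow_def nome_def mult_ac)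
  also have "\<dots> = (\<Sum>\<^sub>\<infinity>j\<in>UNIV. exp ((u\<^sup>2 / of_real r - u) * lq) * theta_term (lq * of_real r) (2 * u * lq) j)"
    unfolding theta_series[OF neg] by (rule infsum_cmult_right'[symmetric])
  also have "\<dots> = (\<Sum>\<^sub>\<infinity>j\<in>UNIV. exp (- lq * of_real r / 4) * brk_term u j)"
  proof (rule infsum_cong)
    fix j :: int
    have e: "(u\<^sup>2 / of_real r - u) * lq + (lq * of_real r * of_int (j * (j - 1)) + 2 * u * lq * of_int j) =
        - lq * of_real r / 4 + lq / of_real r * (u + of_real (r * (real_of_int j + - 1 / 2)))\<^sup>2"
      using r by (simp add: field_simps power2_eq_square)
    show "exp ((u\<^sup>2 / of_real r - u) * lq) * theta_term (lq * of_real r) (2 * u * lq) j =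
        exp (- lq * of_real r / 4) * brk_term u j"
      using arg_cong[OF e, of exp] unfolding theta_term_def brk_term_def exp_add[of _ "_ + _"] exp_add[of "- _ / _"]
      by (cases "even j") (simp_all only: if_True if_False mult_1_left mult_minus_left mult_minus_right exp_add)
  qed
  also have "\<dots> = exp (- lq * of_real r / 4) * (\<Sum>\<^sub>\<infinity>j\<in>UNIV. brk_term u j)"
    by (rule infsum_cmult_right')
  finally show ?thesis .
qed

lemma brk_minus: "brk lq r (- u) = - brk lq r u"
proof -
  have "(\<Sum>\<^sub>\<infinity>j\<in>UNIV. brk_term (- u) j) = (\<Sum>\<^sub>\<infinity>j\<in>UNIV. - brk_term u j)"
  proof (rule infsum_reindex_bij_witness[of _ "\<lambda>j. 1 - j" "\<lambda>j. 1 - j"])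
    fix j :: int
    have "(u + of_real (r * (real_of_int (1 - j) + - 1 / 2)))\<^sup>2 = (- u + of_real (r * (real_of_int j + - 1 / 2)))\<^sup>2"
      by (simp add: power2_eq_square algebra_simps)
    then show "- brk_term u (1 - j) = brk_term (- u) j"
      by (simp add: brk_term_def)
  qed auto
  then show ?thesis by (simp add: brk_series infsum_uminus)
qed

lemma brk_add_mult_brk_diff:
  "brk lq r (u + x) * brk lq r (u - x) = exp (- lq * of_real r / 2) *
     (theta0 (2 * lq / of_real r) r (1 / 2) u * theta0 (2 * lq / of_real r) r 0 x
      - theta0 (2 * lq / of_real r) r 0 u * theta0 (2 * lq / of_real r) r (1 / 2) x)"
proof -
  define T where "T = (\<lambda>(m, n). brk_term (u + x) m * brk_term (u - x) n)"
  define G where "G h y j = exp (2 * lq / of_real r * (y + of_real (r * (real_of_int j + h)))\<^sup>2)" for h y j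
  have G: "theta0 (2 * lq / of_real r) r h y = infsum (G h y) UNIV" for h y
    unfolding theta0_def G_def ..
  have sG: "(\<lambda>j. norm (G h y j)) summable_on UNIV" for h y
    unfolding G_def by (rule abs_summable_on_gaussian[OF Re_neg(2)])
  have "(T has_sum infsum (brk_term (u + x)) UNIV * infsum (brk_term (u - x)) UNIV) UNIV"
    unfolding T_def by (intro has_sum_product abs_summable_brk_term)
  moreover
  have "(T has_sum infsum (G (1/2) u) UNIV * infsum (G 0 x) UNIV + - (infsum (G 0 u) UNIV * infsum (G (1/2) x) UNIV))
     ({(m, n). even (m + n)} \<union> {(m, n). odd (m + n)})"
  proof (rule has_sum_Un_disjoint)
    show "(T has_sum infsum (G (1/2) u) UNIV * infsum (G 0 x) UNIV) {(m, n). even (m + n)}"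
    proof (rule has_sum_reindex_bij_witness[
          where i = "\<lambda>(m, n). ((m + n) div 2 - 1, (m - n) div 2)" and j = "\<lambda>(s, d). (s + 1 + d, s + 1 - d)", THEN iffD1])
      show "((\<lambda>(s, d). G (1/2) u s * G 0 x d) has_sum infsum (G (1/2) u) UNIV * infsum (G 0 x) UNIV) UNIV"
        by (intro has_sum_product sG)
      fix a :: "int \<times> int" obtain s d where a: "a = (s, d)" by (cases a)
      have e: "lq / of_real r * (u + x + of_real (r * (real_of_int (s + 1 + d) + - 1 / 2)))\<^sup>2 +
               lq / of_real r * (u - x + of_real (r * (real_of_int (s + 1 - d) + - 1 / 2)))\<^sup>2 =
           2 * lq / of_real r * (u + of_real (r * (real_of_int s + 1/2)))\<^sup>2 +
           2 * lq / of_real r * (x + of_real (r * (real_of_int d + 0)))\<^sup>2"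
        by (simp add: power2_eq_square algebra_simps add_divide_distrib[symmetric] diff_divide_distrib[symmetric])
      show "T (case a of (s, d) \<Rightarrow> (s + 1 + d, s + 1 - d)) = (case a of (s, d) \<Rightarrow> G (1/2) u s * G 0 x d)"
        unfolding a prod.case T_def G_def mult_exp_exp e[symmetric] unfolding brk_term_def
        by (simp add: mult_exp_exp)
    qed (auto; presburger)+
    show "(T has_sum - (infsum (G 0 u) UNIV * infsum (G (1/2) x) UNIV)) {(m, n). odd (m + n)}"
    proof (rule has_sum_reindex_bij_witness[
          where i = "\<lambda>(m, n). ((m + n) div 2, (m - n) div 2)" and j = "\<lambda>(s, d). (s + 1 + d, s - d)", THEN iffD1])
      show "((\<lambda>x'. - (case x' of (s, d) \<Rightarrow> G 0 u s * G (1/2) x d)) has_sum - (infsum (G 0 u) UNIV * infsum (G (1/2) x) UNIV)) UNIV"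
        by (intro has_sum_uminusI has_sum_product sG)
      fix a :: "int \<times> int" obtain s d where a: "a = (s, d)" by (cases a)
      have e: "lq / of_real r * (u + x + of_real (r * (real_of_int (s + 1 + d) + - 1 / 2)))\<^sup>2 +
               lq / of_real r * (u - x + of_real (r * (real_of_int (s - d) + - 1 / 2)))\<^sup>2 =
           2 * lq / of_real r * (u + of_real (r * (real_of_int s + 0)))\<^sup>2 +
           2 * lq / of_real r * (x + of_real (r * (real_of_int d + 1/2)))\<^sup>2"
        by (simp add: power2_eq_square algebra_simps add_divide_distrib[symmetric] diff_divide_distrib[symmetric])
      show "T (case a of (s, d) \<Rightarrow> (s + 1 + d, s - d)) = - (case a of (s, d) \<Rightarrow> G 0 u s * G (1/2) x d)"
        unfolding a prod.case T_def G_def mult_exp_exp e[symmetric] unfolding brk_term_def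
        by (simp add: mult_exp_exp)
    qed (auto; presburger)+
  qed auto
  moreover have "{(m, n). even (m + n)} \<union> {(m, n). odd (m + n)} = (UNIV :: (int \<times> int) set)" by auto
  ultimately have prod: "infsum (brk_term (u + x)) UNIV * infsum (brk_term (u - x)) UNIV =
     infsum (G (1/2) u) UNIV * infsum (G 0 x) UNIV - infsum (G 0 u) UNIV * infsum (G (1/2) x) UNIV"
    using has_sum_unique by fastforce
  have "exp (- lq * of_real r / 4) * infsum (brk_term (u + x)) UNIV *
        (exp (- lq * of_real r / 4) * infsum (brk_term (u - x)) UNIV) =
      exp (- lq * of_real r / 4) * exp (- lq * of_real r / 4) *
        (infsum (brk_term (u + x)) UNIV * infsum (brk_term (u - x)) UNIV)"
    by (simp only: mult_ac)
  also have "exp (- lq * of_real r / 4) * exp (- lq * of_real r / 4) = exp (- lq * of_real r / 2)"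
    by (simp add: mult_exp_exp)
  finally show ?thesis unfolding brk_series G prod .
qed

end

section \<open>Three-term identities and the local exchange relations\<close>

lemma exchange_one_field:
  fixes e1 :: complex
  assumes "Ad1 * B * D * x1 = Bd1 * A * e1 * Dx + Ad * B1 * D1 * x"
    and "A1 \<noteq> 0" "B1 \<noteq> 0" "x1 \<noteq> 0" "D \<noteq> 0" "D1 \<noteq> 0"
  shows "Ad1 * e1 / (A1 * D1) * (B / B1) =
    Bd1 * e1 / (B1 * D1) * (A / A1) * (e1 * Dx / (D * x1)) + Ad * e1 / (A1 * D) * (x / x1)"
  using assms by (simp add: divide_simps) algebra

lemma exchange_two_field:
  fixes e1 :: complex
  assumes i2: "B * Az1 * x1 * z - x * zm * Az * B1 = e1 * A * Bz1 * xz"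
    and i3: "Aa * Bzb * D * xz = Dx * Ba * Azb * z + x * Dz * Bb * Aza"
    and nz: "A1 \<noteq> 0" "B1 \<noteq> 0" "x1 \<noteq> 0" "D \<noteq> 0" "z \<noteq> 0" "zp \<noteq> 0" "zm \<noteq> 0" "Az1 \<noteq> 0" "Bz1 \<noteq> 0"
      "a \<noteq> 0" "b \<noteq> 0"
  shows "Aa * e1 / (A1 * a) * (B / B1) * (- zp / - z) * (Bzb * e1 / (Bz1 * b)) =
    e1 * Dx / (D * x1) * (Ba * e1 / (B1 * a) * (A / A1) * (- zp / - z) * (Azb * e1 / (Az1 * b))) +
    x / x1 * ((Bzb * e1 / (Bz1 * b) * (Az / Az1) * (zm / z) * (Aa * e1 / (A1 * a))) / (z / zp)
      - Bb * e1 / (B1 * b) * (A / A1) * (- zp / - z) * (Aza * e1 / (Az1 * a)) * (e1 * Dz / (D * - zm)) / (- z / - zm))"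
    (is "?lhs = ?rhs")
proof -
  have "Aa * Bzb * D * (B * Az1 * x1 * z - x * zm * Az * B1) =
      e1 * A * Bz1 * (Dx * Ba * Azb * z + x * Dz * Bb * Aza)"
    unfolding i2 i3[symmetric] by (simp add: mult_ac)
  then have k: "Aa * Bzb * D * B * Az1 * x1 * z =
      Aa * Bzb * D * x * zm * Az * B1 + e1 * A * Bz1 * Dx * Ba * Azb * z + e1 * A * Bz1 * x * Dz * Bb * Aza"
    by (simp add: algebra_simps)
  have "?lhs = Aa * Bzb * D * B * Az1 * x1 * z * (e1 * e1 * zp / (A1 * a * B1 * z * z * Bz1 * b * Az1 * x1 * D))"
    using nz by (simp add: divide_simps)
  also have "\<dots> = ?rhs"
    unfolding k using nz by (simp add: divide_simps ring_distribs)
  finally show ?thesis .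
qed

lemma exchange_same_field:
  fixes e1 :: complex
  assumes i4: "x1 * z * p' = e1 * xz * p + zm * x * q" and i5: "x1 * z * q' = zp * x * p - e1 * xm * q"
    and i2: "B * Az1 * x1 * z - x * zm * Az * B1 = e1 * A * Bz1 * xz"
    and i2': "Bz * A1 * x1 * z - x * zp * A * Bz1 = - e1 * Az * B1 * xm"
    and nz: "x1 \<noteq> 0" "z \<noteq> 0"
  shows "p * B * Az1 * zp + q * Bz * A1 * zm = p' * A * Bz1 * zp + q' * Az * B1 * zm"
proof -
  have "x1 * z * (p' * A * Bz1 * zp + q' * Az * B1 * zm) =
      (x1 * z * p') * (A * Bz1 * zp) + (x1 * z * q') * (Az * B1 * zm)"
    by (simp add: algebra_simps)
  also have "\<dots> = p * zp * (e1 * A * Bz1 * xz + x * zm * Az * B1) + q * zm * (x * zp * A * Bz1 + - e1 * Az * B1 * xm)"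
    unfolding i4 i5 by (simp add: algebra_simps)
  also have "\<dots> = x1 * z * (p * B * Az1 * zp + q * Bz * A1 * zm)"
    unfolding i2[symmetric] i2'[symmetric] by (simp add: algebra_simps)
  finally show ?thesis using nz by simp
qed

locale weierstrass_sigma =
  fixes f :: "complex \<Rightarrow> complex"
  assumes minus: "f (- x) = - f x"
    and three_term_half: "f (a + b) * f (a - b) * (f (c + d) * f (c - d)) - f (a + c) * f (a - c) * (f (b + d) * f (b - d))
      + f (a + d) * f (a - d) * (f (b + c) * f (b - c)) = 0"
begin

lemma minus_commute: "f (x - y) = - f (y - x)"
  using minus[of "y - x"] by simp

lemma zero [simp]: "f 0 = 0"
  using minus[of 0] by simp

text \<open>The four half-sums of \<open>three_term_half\<close> are eliminated in favour of
  \<open>s = a + b\<close>, \<open>p = a - b\<close>, \<open>q = a - c\<close>, \<open>t = a - d\<close>.\<close>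
lemma three_term:
  "f s * f p * f (s + p - q - t) * f (t - q) - f (s + p - q) * f q * f (s - t) * f (t - p)
   + f (s + p - t) * f t * f (s - q) * f (q - p) = 0"
proof -
  have *: "(s + p) / 2 + (s - p) / 2 = s" "(s + p) / 2 - (s - p) / 2 = p"
    "((s + p) / 2 - q) + ((s + p) / 2 - t) = s + p - q - t" "((s + p) / 2 - q) - ((s + p) / 2 - t) = t - q"
    "(s + p) / 2 + ((s + p) / 2 - q) = s + p - q" "(s + p) / 2 - ((s + p) / 2 - q) = q"
    "(s - p) / 2 + ((s + p) / 2 - t) = s - t" "(s - p) / 2 - ((s + p) / 2 - t) = t - p"
    "(s + p) / 2 + ((s + p) / 2 - t) = s + p - t" "(s + p) / 2 - ((s + p) / 2 - t) = t"
    "(s - p) / 2 + ((s + p) / 2 - q) = s - q" "(s - p) / 2 - ((s + p) / 2 - q) = q - p"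
    by (simp_all add: field_simps)
  show ?thesis
    using three_term_half[of "(s + p) / 2" "(s - p) / 2" "(s + p) / 2 - q" "(s + p) / 2 - t"]
    unfolding * by (simp only: mult.assoc)
qed

lemma ident1:
  "f (A + D + 1) * f B * f D * f (B - A + 1) =
   f (B + D + 1) * f A * f 1 * f (D - (B - A)) + f (A + D) * f (B + 1) * f (D + 1) * f (B - A)"
  using three_term[of "A + D + 1" B A "B + 1"] minus_commute[of A B]
  by (simp add: algebra_simps)

lemma ident2:
  "f B * f (A - z + 1) * f (B - A + 1) * f z - f (B - A) * f (z - 1) * f (A - z) * f (B + 1) =
   f 1 * f A * f (B - z + 1) * f (B - A + z)"
  using three_term[of B "A - z + 1" "A - z" A] minus_commute[of 1 z] minus[of 1]
  by (simp add: algebra_simps)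

lemma ident3:
  "f (A + a) * f (B - z + b) * f (a - b) * f (B - A + z) =
   f (a - b - (B - A)) * f (B + a) * f (A - z + b) * f z + f (B - A) * f (a - b + z) * f (B + b) * f (A - z + a)"
  using three_term[of "A + a" "B - z + b" "A - z + b" "B + b"] minus_commute[of A B]
  by (simp add: algebra_simps)

lemma ident4:
  "f (B - A + 1) * f z * (f (B + b - 1) * f (A - z + b)) =
   f 1 * f (B - A + z) * (f (A + b - 1) * f (B - z + b)) + f (z - 1) * f (B - A) * (f (A - z + b - 1) * f (B + b))"
  using three_term[of "B + b - 1" "A - z + b" "A - z + b - 1" "A + b - 1"] minus_commute[of A B] minus_commute[of 1 z] minus[of 1]
  by (simp add: algebra_simps)

lemma ident5:
  "f (B - A + 1) * f z * (f (B - z + b - 1) * f (A + b)) =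
   f (z + 1) * f (B - A) * (f (A + b - 1) * f (B - z + b)) - f 1 * f (B - A - z) * (f (A - z + b - 1) * f (B + b))"
  using three_term[of "B - z + b - 1" "A + b" "A - z + b - 1" "A + b - 1"] minus_commute[of A B]
    minus[of "z + 1"] minus[of 1] minus_commute[of B "A + z"]
  by (simp add: algebra_simps)

lemma ident6:
  "f D * f D * f (x + 1) * f (1 - x) = f 1 * f 1 * f (D - x) * f (D + x) - f x * f x * f (D + 1) * f (D - 1)"
  using three_term[of D D "D - 1" "D - x"] minus[of x] minus[of 1]
  by (simp add: algebra_simps)

definition \<phi> :: "complex \<Rightarrow> complex \<Rightarrow> complex" where "\<phi> x d = f (x + d) * f 1 / (f (x + 1) * f d)"
definition \<gamma> :: "complex \<Rightarrow> complex" where "\<gamma> x = f x / f (x + 1)"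
definition \<eta> :: "complex \<Rightarrow> complex" where "\<eta> x = f (x - 1) / f x"
definition \<kappa> :: "complex \<Rightarrow> complex \<Rightarrow> complex" where "\<kappa> x d = f 1 * f (d - x) / (f d * f (x + 1))"

lemma exchange_one:
  assumes "f (A + 1) \<noteq> 0" "f (B + 1) \<noteq> 0" "f (B - A + 1) \<noteq> 0" "f D \<noteq> 0" "f (D + 1) \<noteq> 0"
  shows "\<phi> A (D + 1) * \<gamma> B = \<phi> B (D + 1) * \<gamma> A * \<kappa> (B - A) D + \<phi> A D * \<gamma> (B - A)"
  unfolding \<phi>_def \<gamma>_def \<kappa>_def
  by (rule exchange_one_field[OF _ assms]) (use ident1[of A D B] in \<open>simp add: add.assoc\<close>)

definition \<Phi> :: "complex \<Rightarrow> complex \<Rightarrow> complex \<Rightarrow> complex \<Rightarrow> complex \<Rightarrow> complex \<Rightarrow> complex" where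
  "\<Phi> a b y1 y2 w1 w2 = \<phi> (w1 - y1) a * \<gamma> (w2 - y1) * \<eta> (y1 - y2) * \<phi> (w2 - y2) b"

lemma exchange_two_coefficient:
  assumes "f (A + 1) \<noteq> 0" "f (B + 1) \<noteq> 0" "f (B - A + 1) \<noteq> 0" "f (a - b) \<noteq> 0"
    "f z \<noteq> 0" "f (z + 1) \<noteq> 0" "f (z - 1) \<noteq> 0" "f (A - z + 1) \<noteq> 0" "f (B - z + 1) \<noteq> 0" "f a \<noteq> 0" "f b \<noteq> 0"
  shows "\<phi> A a * \<gamma> B * \<eta> (- z) * \<phi> (B - z) b =
    \<kappa> (B - A) (a - b) * (\<phi> B a * \<gamma> A * \<eta> (- z) * \<phi> (A - z) b) +
    \<gamma> (B - A) * (\<phi> (B - z) b * \<gamma> (A - z) * \<eta> z * \<phi> A a / \<gamma> z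
      - \<phi> B b * \<gamma> A * \<eta> (- z) * \<phi> (A - z) a * \<kappa> (- z) (a - b) / \<gamma> (- z))"
proof -
  have m: "f (- z) = - f z" "f (- z - 1) = - f (z + 1)" "f (- z + 1) = - f (z - 1)" "f (a - b - - z) = f (a - b + z)"
    using minus[of z] minus[of "z + 1"] minus[of "z - 1"]
    by (simp_all only: minus_add_distrib minus_diff_eq diff_conv_add_uminus add.inverse_inverse add.commute)
  show ?thesis
    unfolding \<phi>_def \<gamma>_def \<kappa>_def \<eta>_def m
    by (rule exchange_two_field[OF ident2 ident3 assms])
qed

context
  fixes w1 w2 y1 y2 :: complex
  assumes nz: "f (w1 - y1 + 1) \<noteq> 0" "f (w2 - y1 + 1) \<noteq> 0" "f (w1 - y2 + 1) \<noteq> 0" "f (w2 - y2 + 1) \<noteq> 0"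
    "f (w2 - w1 + 1) \<noteq> 0" "f (y2 - y1) \<noteq> 0" "f (y2 - y1 + 1) \<noteq> 0" "f (y1 - y2 + 1) \<noteq> 0"
begin

lemma exchange_two_coefficient':
  assumes "f a \<noteq> 0" "f b \<noteq> 0" "f (a - b) \<noteq> 0"
  shows "\<Phi> a b y1 y2 w1 w2 = \<kappa> (w2 - w1) (a - b) * \<Phi> a b y1 y2 w2 w1 + \<gamma> (w2 - w1) *
    (\<Phi> b a y2 y1 w2 w1 / \<gamma> (y2 - y1) - \<Phi> b a y1 y2 w2 w1 * \<kappa> (y1 - y2) (a - b) / \<gamma> (y1 - y2))"
    and "\<Phi> a b y2 y1 w1 w2 = \<kappa> (w2 - w1) (a - b) * \<Phi> a b y2 y1 w2 w1 + \<gamma> (w2 - w1) *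
    (\<Phi> b a y1 y2 w2 w1 / \<gamma> (y1 - y2) - \<Phi> b a y2 y1 w2 w1 * \<kappa> (y2 - y1) (a - b) / \<gamma> (y2 - y1))"
proof -
  have s: "w2 - y1 - (w1 - y1) = w2 - w1" "w1 - y1 - (y2 - y1) = w1 - y2" "w2 - y1 - (y2 - y1) = w2 - y2"
     "- (y2 - y1) = y1 - y2" "w2 - y2 - (w1 - y2) = w2 - w1" "w1 - y2 - (y1 - y2) = w1 - y1" "w2 - y2 - (y1 - y2) = w2 - y1"
     "- (y1 - y2) = y2 - y1"
    by simp_all
  have n: "f (y2 - y1 - 1) \<noteq> 0" "f (y1 - y2 - 1) \<noteq> 0" "f (y1 - y2) \<noteq> 0"
    using nz(6-8) minus[of "y1 - y2 + 1"] minus[of "y2 - y1 + 1"] minus[of "y2 - y1"] by (auto simp: algebra_simps)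
  show "\<Phi> a b y1 y2 w1 w2 = \<kappa> (w2 - w1) (a - b) * \<Phi> a b y1 y2 w2 w1 + \<gamma> (w2 - w1) *
    (\<Phi> b a y2 y1 w2 w1 / \<gamma> (y2 - y1) - \<Phi> b a y1 y2 w2 w1 * \<kappa> (y1 - y2) (a - b) / \<gamma> (y1 - y2))"
    using exchange_two_coefficient[of "w1 - y1" "w2 - y1" a b "y2 - y1"] nz n assms unfolding s \<Phi>_def by blast
  show "\<Phi> a b y2 y1 w1 w2 = \<kappa> (w2 - w1) (a - b) * \<Phi> a b y2 y1 w2 w1 + \<gamma> (w2 - w1) *
    (\<Phi> b a y1 y2 w2 w1 / \<gamma> (y1 - y2) - \<Phi> b a y2 y1 w2 w1 * \<kappa> (y2 - y1) (a - b) / \<gamma> (y2 - y1))"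
    using exchange_two_coefficient[of "w1 - y2" "w2 - y2" a b "y1 - y2"] nz n assms unfolding s \<Phi>_def by blast
qed

lemma exchange_two:
  assumes "f a \<noteq> 0" "f b \<noteq> 0" "f (a - b) \<noteq> 0"
    and g: "g = g' * \<kappa> (y2 - y1) (a - b) + h' * \<gamma> (y2 - y1)"
    and g': "g' = g * \<kappa> (y1 - y2) (a - b) + h * \<gamma> (y1 - y2)"
  shows "\<Phi> a b y1 y2 w1 w2 * g + \<Phi> a b y2 y1 w1 w2 * g' =
    (\<Phi> a b y1 y2 w2 w1 * g + \<Phi> a b y2 y1 w2 w1 * g') * \<kappa> (w2 - w1) (a - b) +
    (\<Phi> b a y1 y2 w2 w1 * h + \<Phi> b a y2 y1 w2 w1 * h') * \<gamma> (w2 - w1)"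
proof -
  have n: "\<gamma> (y2 - y1) \<noteq> 0" "\<gamma> (y1 - y2) \<noteq> 0"
    using nz(6-8) minus[of "y2 - y1"] by (auto simp: \<gamma>_def)
  have h': "h' = (g - g' * \<kappa> (y2 - y1) (a - b)) / \<gamma> (y2 - y1)"
    using g n by (simp add: field_simps)
  have h: "h = (g' - g * \<kappa> (y1 - y2) (a - b)) / \<gamma> (y1 - y2)"
    using g' n by (simp add: field_simps)
  show ?thesis
    unfolding exchange_two_coefficient'[OF assms(1-3)] h h'
    by (simp add: algebra_simps add_divide_distrib diff_divide_distrib)
qed

lemma exchange_same:
  assumes "f b \<noteq> 0" "f (b - 1) \<noteq> 0"
  shows "\<Phi> (b - 1) b y1 y2 w1 w2 + \<Phi> (b - 1) b y2 y1 w1 w2 =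
    \<Phi> (b - 1) b y1 y2 w2 w1 + \<Phi> (b - 1) b y2 y1 w2 w1"
proof -
  define A B z where "A = w1 - y1" and "B = w2 - y1" and "z = y2 - y1"
  have s: "w2 - y2 = B - z" "w1 - y2 = A - z" "y1 - y2 = - z" "w2 - w1 = B - A"
    by (simp_all add: A_def B_def z_def)
  note n = nz[folded A_def B_def z_def, unfolded s]
  have m: "f (- z) = - f z" "f (- z - 1) = - f (z + 1)"
    using minus[of z] minus[of "z + 1"] by (simp_all only: minus_add_distrib diff_conv_add_uminus)
  have i2': "f (B - z) * f (A + 1) * f (B - A + 1) * f z - f (B - A) * f (z + 1) * f A * f (B - z + 1) =
      - f 1 * f (A - z) * f (B + 1) * f (B - A - z)"
    using ident2[of "B - z" "A - z" "- z"] m by (simp add: algebra_simps)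
  have key: "f (A + b - 1) * f (B - z + b) * f B * f (A - z + 1) * f (z + 1) +
        f (A - z + b - 1) * f (B + b) * f (B - z) * f (A + 1) * f (z - 1) =
      f (B + b - 1) * f (A - z + b) * f A * f (B - z + 1) * f (z + 1) +
        f (B - z + b - 1) * f (A + b) * f (A - z) * f (B + 1) * f (z - 1)"
    by (rule exchange_same_field[OF ident4 ident5 ident2 i2']) (use n in auto)
  have Phi: "\<Phi> (b - 1) b y1 y2 w1 w2 + \<Phi> (b - 1) b y2 y1 w1 w2 =
      (f (A + b - 1) * f (B - z + b) * f B * f (A - z + 1) * f (z + 1) +
        f (A - z + b - 1) * f (B + b) * f (B - z) * f (A + 1) * f (z - 1)) * (f 1 * f 1) /
      (f (A + 1) * f (B + 1) * f (A - z + 1) * f (B - z + 1) * f b * f (b - 1) * f z)"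
    if "f (A + 1) \<noteq> 0" "f (B + 1) \<noteq> 0" "f (A - z + 1) \<noteq> 0" "f (B - z + 1) \<noteq> 0" "f z \<noteq> 0"
      "w1 - y1 = A" "w2 - y1 = B" "w1 - y2 = A - z" "w2 - y2 = B - z" "y1 - y2 = - z" "y2 - y1 = z" for A B w1 w2
    unfolding \<Phi>_def \<phi>_def \<gamma>_def \<eta>_def that(6-11) m using assms that(1-5)
    by (simp add: divide_simps) (simp add: algebra_simps)
  show ?thesis
    using key Phi[of A B w1 w2] Phi[of B A w2 w1] n s
    by (simp add: A_def[symmetric] B_def[symmetric] z_def[symmetric] mult_ac)
qed

end

text \<open>Solves the exchange relation at \<open>x\<close> and at \<open>- x\<close> for \<open>M\<close>, so the descending case needs no separate proof.\<close>
lemma exchange_inverse: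
  assumes nz: "f x \<noteq> 0" "f (x + 1) \<noteq> 0" "f (1 - x) \<noteq> 0" "f D \<noteq> 0"
    and L: "L = L' * \<kappa> x D + M' * \<gamma> x" and L': "L' = L * \<kappa> (- x) D + M * \<gamma> (- x)"
  shows "M = M' * (f 1 * f (D + x) / (f D * f (x + 1))) + L' * (f (D + 1) * f (D - 1) * f x / ((f D)\<^sup>2 * f (x + 1)))"
proof -
  have "M * \<gamma> (- x) = L' - L * \<kappa> (- x) D" using L' by simp
  also have "\<dots> = L' * (1 - \<kappa> x D * \<kappa> (- x) D) - M' * (\<gamma> x * \<kappa> (- x) D)"
    unfolding L by (simp add: algebra_simps)
  also have "1 - \<kappa> x D * \<kappa> (- x) D = - (f x * f x * f (D + 1) * f (D - 1)) / (f D * f D * f (x + 1) * f (1 - x))"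
  proof -
    have "\<kappa> x D * \<kappa> (- x) D = f 1 * f 1 * f (D - x) * f (D + x) / (f D * f D * f (x + 1) * f (1 - x))"
      by (simp add: \<kappa>_def mult_ac)
    moreover have "f D * f D * f (x + 1) * f (1 - x) \<noteq> 0" using nz by simp
    ultimately have "1 - \<kappa> x D * \<kappa> (- x) D =
        (f D * f D * f (x + 1) * f (1 - x) - f 1 * f 1 * f (D - x) * f (D + x)) / (f D * f D * f (x + 1) * f (1 - x))"
      by (simp only: diff_divide_distrib divide_self simp_thms not_False_eq_True)
    then show ?thesis unfolding ident6 by simp
  qed
  also have "\<dots> = \<gamma> (- x) * (f (D + 1) * f (D - 1) * f x / ((f D)\<^sup>2 * f (x + 1)))"
    using nz minus[of x] unfolding \<gamma>_def by (simp add: power2_eq_square mult_ac)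
  also have "\<gamma> x * \<kappa> (- x) D = - \<gamma> (- x) * (f 1 * f (D + x) / (f D * f (x + 1)))"
    using nz minus[of x] unfolding \<gamma>_def \<kappa>_def by simp
  finally have "\<gamma> (- x) * M = \<gamma> (- x) * (M' * (f 1 * f (D + x) / (f D * f (x + 1)))
      + L' * (f (D + 1) * f (D - 1) * f x / ((f D)\<^sup>2 * f (x + 1))))"
    by (simp add: algebra_simps)
  then show ?thesis using nz minus[of x] by (simp add: \<gamma>_def)
qed

end

section \<open>Weight functions indexed by positions\<close>

abbreviation adj :: "nat \<Rightarrow> nat \<Rightarrow> nat" where "adj i \<equiv> swp i (\<lambda>s. s)"

lemma swp_apply: "swp i g s = (if s = i then g (Suc i) else if s = Suc i then g i else g s)"
  by (simp add: swp_def)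

lemma swp_other: "s \<notin> {i, Suc i} \<Longrightarrow> swp i g s = g s"
  by (simp add: swp_apply)

lemma swp_left [simp]: "swp i g i = g (Suc i)" and swp_right [simp]: "swp i g (Suc i) = g i"
  by (simp_all add: swp_apply)

lemma swp_swp [simp]: "swp i (swp i g) = g"
  by (simp add: swp_apply fun_eq_iff)

lemma swp_adj: "swp i g (adj i s) = g s"
  by (simp add: swp_apply)

lemma adj_adj [simp]: "adj i (adj i s) = s"
  by (simp add: swp_apply)

lemma inj_on_adj: "inj_on (adj i) A"
  by (metis adj_adj inj_onI)

lemma adj_in: "i \<in> {1..<n} \<Longrightarrow> adj i s \<in> {1..n} \<longleftrightarrow> s \<in> {1..n}"
  by (auto simp: swp_apply)

lemma adj_less:
  "\<not> (s = i \<and> s' = Suc i) \<Longrightarrow> \<not> (s = Suc i \<and> s' = i) \<Longrightarrow> adj i s < adj i s' \<longleftrightarrow> s < s'"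
  by (auto simp: swp_apply)

lemma greaterThan_swp:
  assumes "i \<in> {1..<n}" "\<And>k. Q (J k) \<Longrightarrow> \<not> (s = i \<and> k = Suc i) \<and> \<not> (s = Suc i \<and> k = i)"
  shows "{k \<in> {adj i s<..n}. Q (swp i J k)} = adj i ` {k \<in> {s<..n}. Q (J k)}"
proof -
  have *: "adj i k \<in> {adj i s<..n} \<longleftrightarrow> k \<in> {s<..n}" if "Q (J k)" for k
    using adj_less[of s i k] adj_in[OF assms(1), of k] assms(2)[OF that] by auto
  show ?thesis
  proof (intro equalityI subsetI)
    fix k assume k: "k \<in> {k \<in> {adj i s<..n}. Q (swp i J k)}"
    then have "Q (J (adj i k))" using swp_adj[of i J "adj i k"] by simp
    with k *[of "adj i k"] have "adj i k \<in> {k \<in> {s<..n}. Q (J k)}" by simp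
    then show "k \<in> adj i ` {k \<in> {s<..n}. Q (J k)}" by (metis adj_adj imageI)
  next
    fix k assume "k \<in> adj i ` {k \<in> {s<..n}. Q (J k)}"
    then show "k \<in> {k \<in> {adj i s<..n}. Q (swp i J k)}" using * by (auto simp: swp_adj)
  qed
qed

lemma Jset_iff: "s \<in> Jset J n l \<longleftrightarrow> s \<in> {1..n} \<and> J s \<le> l"
  by (simp add: Jset_def)

lemma finite_Jset [simp]: "finite (Jset J n l)"
  by (simp add: Jset_def)

lemma Jset_greater: "{s' \<in> Jset J n l. s < s'} = {s' \<in> {s<..n}. J s' \<le> l}"
  by (auto simp: Jset_def)

lemma Jset_swp:
  assumes "i \<in> {1..<n}"
  shows "Jset (swp i J) n l = adj i ` Jset J n l"
proof (intro equalityI subsetI)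
  fix s assume "s \<in> Jset (swp i J) n l"
  then have "adj i s \<in> Jset J n l" using adj_in[OF assms] swp_adj[of i J "adj i s"] by (simp add: Jset_iff)
  then show "s \<in> adj i ` Jset J n l" by (metis adj_adj imageI)
next
  fix s assume "s \<in> adj i ` Jset J n l"
  then obtain t where "s = adj i t" "t \<in> Jset J n l" by blast
  then show "s \<in> Jset (swp i J) n l" using adj_in[OF assms, of t] by (simp add: Jset_iff swp_adj)
qed

lemma adj_Jset:
  assumes "i \<in> {1..<n}" "J i \<le> l \<longleftrightarrow> J (Suc i) \<le> l"
  shows "adj i ` Jset J n l = Jset J n l"
proof -
  have "adj i s \<in> Jset J n l \<longleftrightarrow> s \<in> Jset J n l" for s
    using assms by (auto simp: Jset_iff swp_apply)
  then show ?thesis by (metis (no_types, lifting) adj_adj image_iff subsetI subset_antisym)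
qed

definition Bij :: "nat set \<Rightarrow> 'a set \<Rightarrow> (nat \<Rightarrow> 'a) set" where
  "Bij A T = {y \<in> extensional A. bij_betw y A T}"

lemma swp_Bij: 
  assumes "y \<in> Bij A T"
  shows "swp i y \<in> Bij (adj i ` A) T"
proof -
  have "bij_betw (swp i y \<circ> adj i) A T"
    using assms by (simp add: Bij_def o_def swp_adj)
  moreover have "bij_betw (adj i) A (adj i ` A)" by (simp add: inj_on_adj bij_betw_def)
  ultimately have "bij_betw (swp i y) (adj i ` A) T"
    using bij_betw_comp_iff by blast
  moreover have "swp i y \<in> extensional (adj i ` A)"
    unfolding extensional_def
  proof (intro CollectI allI impI)
    fix s assume "s \<notin> adj i ` A"
    then have "adj i s \<notin> A" by (metis adj_adj imageI)
    then have "y (adj i s) = undefined"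
      using assms extensional_arb[of y A "adj i s"] by (simp add: Bij_def)
    then show "swp i y s = undefined" by (metis adj_adj swp_adj)
  qed
  ultimately show ?thesis by (simp add: Bij_def)
qed

lemma sum_Bij_swp: "(\<Sum>y\<in>Bij (adj i ` A) T. X y) = (\<Sum>y\<in>Bij A T. X (swp i y))"
proof (rule sum.reindex_bij_witness[of _ "swp i" "swp i"])
  fix y assume "y \<in> Bij (adj i ` A) T"
  then show "swp i y \<in> Bij A T" using swp_Bij[of y "adj i ` A" T i] by (simp add: image_image)
qed (auto intro: swp_Bij)

lemma sum_Bij_symmetrize:
  fixes X :: "(nat \<Rightarrow> 'a) \<Rightarrow> complex"
  assumes "adj i ` A = A"
  shows "2 * (\<Sum>y\<in>Bij A T. X y) = (\<Sum>y\<in>Bij A T. X y + X (swp i y))"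
  using sum_Bij_swp[of X i A T] assms by (simp add: sum.distrib)

definition cnt :: "nat \<Rightarrow> nat \<Rightarrow> (nat \<Rightarrow> nat) \<Rightarrow> nat \<Rightarrow> nat" where
  "cnt n i J c = card {k \<in> {Suc i<..n}. J k = c}"

lemma cnt_swp [simp]: "cnt n i (swp i J) = cnt n i J"
  unfolding cnt_def by (intro ext arg_cong[where f = card]) (auto simp: swp_apply)

lemma card_greater_Suc:
  assumes "i < n"
  shows "card {k \<in> {i<..n}. J k = c} = cnt n i J c + (if J (Suc i) = c then 1 else 0)"
proof -
  have "{k \<in> {i<..n}. J k = c} = (if J (Suc i) = c then insert (Suc i) {k \<in> {Suc i<..n}. J k = c} else {k \<in> {Suc i<..n}. J k = c})"
    using assms by (auto simp: less_Suc_eq_le) (metis Suc_leI le_neq_implies_less)+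
  then show ?thesis by (simp add: cnt_def)
qed

text \<open>\<open>T l\<close> is the set of values of the level-\<open>l\<close> variables; the weight function is symmetric in
  them, so no labelling is fixed. \<open>S\<close> contains the values of all levels, including the top one.\<close>
locale weight_function = weierstrass_sigma f for f +
  fixes N n :: nat and P' :: "nat \<Rightarrow> complex" and T :: "nat \<Rightarrow> complex set" and S :: "complex set"
  assumes f_int: "m \<noteq> 0 \<Longrightarrow> f (of_int m) \<noteq> 0"
    and f_P: "a \<in> {1..N} \<Longrightarrow> b \<in> {1..N} \<Longrightarrow> a \<noteq> b \<Longrightarrow> f (P' a - P' b + of_int m) \<noteq> 0"
    and f_S: "s \<in> S \<Longrightarrow> t \<in> S \<Longrightarrow> s \<noteq> t \<Longrightarrow> f (s - t + of_int m) \<noteq> 0"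
    and T_S: "T l \<subseteq> S"
begin

definition dyn :: "(nat \<Rightarrow> nat) \<Rightarrow> nat \<Rightarrow> nat \<Rightarrow> complex" where
  "dyn J l s = P' (J s) - P' (Suc l) - of_int (Cnum J n l s)"

text \<open>\<open>y\<close> and \<open>w\<close> are the variables of levels \<open>l\<close> and \<open>l + 1\<close>, indexed by positions in \<open>{1..n}\<close> instead
  of by ranks: the index \<open>b\<^sub>0\<close> of \<open>Utilde\<close> then disappears.\<close>
definition fac :: "nat \<Rightarrow> (nat \<Rightarrow> nat) \<Rightarrow> (nat \<Rightarrow> complex) \<Rightarrow> (nat \<Rightarrow> complex) \<Rightarrow> nat \<Rightarrow> complex" where
  "fac l J y w s = \<phi> (w s - y s) (dyn J l s) * (\<Prod>s'\<in>{s' \<in> Jset J n (Suc l). s < s'}. \<gamma> (w s' - y s))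
     * (\<Prod>s'\<in>{s' \<in> Jset J n l. s < s'}. \<eta> (y s - y s'))"

definition blk :: "nat \<Rightarrow> (nat \<Rightarrow> nat) \<Rightarrow> (nat \<Rightarrow> complex) \<Rightarrow> (nat \<Rightarrow> complex) \<Rightarrow> complex" where
  "blk l J y w = (\<Prod>s\<in>Jset J n l. fac l J y w s)"

primrec G :: "nat \<Rightarrow> (nat \<Rightarrow> nat) \<Rightarrow> (nat \<Rightarrow> complex) \<Rightarrow> complex" where
  "G 0 J w = 1"
| "G (Suc l) J w = (\<Sum>y\<in>Bij (Jset J n l) (T l). blk l J y w * G l J y)"

lemma fac_relabel:
  assumes i: "i \<in> {1..<n}" and s: "s \<in> Jset J n l"
    and c: "s \<notin> {i, Suc i} \<or> \<not> (J i \<le> Suc l \<and> J (Suc i) \<le> Suc l)"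
  shows "fac l (swp i J) (swp i y) (swp i w) (adj i s) = fac l J y w s"
proof -
  have js: "J s \<le> l" using s by (simp add: Jset_iff)
  have up: "{k \<in> {adj i s<..n}. Q (swp i J k)} = adj i ` {k \<in> {s<..n}. Q (J k)}"
    if "\<And>c. Q c \<Longrightarrow> c \<le> Suc l" for Q
    using c js that by (intro greaterThan_swp i) auto
  have "Cnum (swp i J) n l (adj i s) = Cnum J n l s"
    unfolding Cnum_def swp_adj using js
    by (subst up, force, subst up, force) (simp add: card_image inj_on_adj)
  then have d: "dyn (swp i J) l (adj i s) = dyn J l s"
    by (simp add: dyn_def swp_adj)
  show ?thesis
    unfolding fac_def d swp_adj Jset_greater
    by (subst up, force, subst up, force) (simp add: prod.reindex inj_on_adj swp_adj)
qed

lemma fac_swp_top: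
  assumes i: "i \<in> {1..<n}" and J: "J i \<le> Suc l" "J (Suc i) \<le> Suc l" and s: "s \<notin> {i, Suc i}"
  shows "fac l J y (swp i w) s = fac l J y w s"
proof -
  have "(\<Prod>s'\<in>{s' \<in> Jset J n (Suc l). s < s'}. \<gamma> (swp i w s' - y s)) =
      (\<Prod>s'\<in>{s' \<in> Jset J n (Suc l). s < s'}. \<gamma> (w s' - y s))"
    by (rule prod.reindex_bij_witness[of _ "adj i" "adj i"])
       (use i J s in \<open>auto simp: Jset_iff swp_apply\<close>)
  then show ?thesis by (simp add: fac_def swp_other[OF s])
qed

lemma fac_swp_bottom:
  assumes i: "i \<in> {1..<n}" and J: "J i \<le> l" "J (Suc i) \<le> l" and s: "s \<notin> {i, Suc i}"
  shows "fac l J (swp i y) w s = fac l J y w s"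
proof -
  have "(\<Prod>s'\<in>{s' \<in> Jset J n l. s < s'}. \<eta> (y s - swp i y s')) =
      (\<Prod>s'\<in>{s' \<in> Jset J n l. s < s'}. \<eta> (y s - y s'))"
    by (rule prod.reindex_bij_witness[of _ "adj i" "adj i"])
       (use i J s in \<open>auto simp: Jset_iff swp_apply\<close>)
  then show ?thesis by (simp add: fac_def swp_other[OF s])
qed

lemma fac_swp_colours:
  assumes i: "i \<in> {1..<n}" and J: "J i \<le> l" "J (Suc i) \<le> l" and s: "s \<in> Jset J n l" "s \<notin> {i, Suc i}"
  shows "fac l (swp i J) y w s = fac l J y w s"
proof -
  have "fac l (swp i J) (swp i (swp i y)) (swp i (swp i w)) (adj i s) = fac l J (swp i y) (swp i w) s"
    using i s by (intro fac_relabel) auto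
  also have "\<dots> = fac l J y w s"
    using J by (simp add: fac_swp_top[OF i _ _ s(2)] fac_swp_bottom[OF i _ _ s(2)])
  finally show ?thesis using s(2) by (simp add: swp_other)
qed

lemma blk_relabel:
  assumes i: "i \<in> {1..<n}" and c: "\<not> (J i \<le> Suc l \<and> J (Suc i) \<le> Suc l)"
  shows "blk l (swp i J) (swp i y) (swp i w) = blk l J y w"
proof -
  have "fac l (swp i J) (swp i y) (swp i w) (adj i s) = fac l J y w s" if "s \<in> Jset J n l" for s
    using c by (intro fac_relabel[OF i that]) blast
  then show ?thesis by (simp add: blk_def Jset_swp[OF i] prod.reindex inj_on_adj)
qed

lemma G_relabel:
  assumes i: "i \<in> {1..<n}" and c: "\<not> (J i \<le> l \<and> J (Suc i) \<le> l)"
  shows "G l (swp i J) (swp i w) = G l J w"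
  using c
proof (induction l arbitrary: w)
  case (Suc l)
  have c: "\<not> (J i \<le> l \<and> J (Suc i) \<le> l)" using Suc.prems by auto
  have "G (Suc l) (swp i J) (swp i w) =
      (\<Sum>y\<in>Bij (Jset J n l) (T l). blk l (swp i J) (swp i y) (swp i w) * G l (swp i J) (swp i y))"
    by (simp add: Jset_swp[OF i] sum_Bij_swp)
  also have "\<dots> = G (Suc l) J w"
    by (simp add: blk_relabel[OF i Suc.prems] Suc.IH[OF c])
  finally show ?case .
qed simp

definition tail :: "nat \<Rightarrow> nat \<Rightarrow> (nat \<Rightarrow> nat) \<Rightarrow> (nat \<Rightarrow> complex) \<Rightarrow> (nat \<Rightarrow> complex) \<Rightarrow> complex \<Rightarrow> complex" where
  "tail i l J y w t = (\<Prod>s'\<in>{s' \<in> Jset J n (Suc l). Suc i < s'}. \<gamma> (w s' - t))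
     * (\<Prod>s'\<in>{s' \<in> Jset J n l. Suc i < s'}. \<eta> (t - y s'))"

lemma tail_swp:
  "tail i l (swp i J) y w t = tail i l J y w t"
  "tail i l J (swp i y) w t = tail i l J y w t"
  "tail i l J y (swp i w) t = tail i l J y w t"
proof -
  have "{s' \<in> {Suc i<..n}. swp i J s' \<le> k} = {s' \<in> {Suc i<..n}. J s' \<le> k}" for k
    by (auto simp: swp_apply)
  then show "tail i l (swp i J) y w t = tail i l J y w t"
    unfolding tail_def Jset_greater by simp
  show "tail i l J (swp i y) w t = tail i l J y w t"
    unfolding tail_def Jset_greater by (intro arg_cong2[where f = times] refl prod.cong) (simp add: swp_apply)
  show "tail i l J y (swp i w) t = tail i l J y w t"
    unfolding tail_def Jset_greater by (intro arg_cong2[where f = times] refl prod.cong) (simp add: swp_apply)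
qed

text \<open>The dynamical parameter seen at positions \<open>i\<close>, \<open>i + 1\<close>, counted from the right end. If the two
  colours there differ, it exceeds the left-counted \<open>Pshift P J i\<close> by 1 on both of them.\<close>
definition dpar :: "nat \<Rightarrow> (nat \<Rightarrow> nat) \<Rightarrow> nat \<Rightarrow> complex" where
  "dpar i J c = P' c - of_nat (cnt n i J c)"

lemma dpar_swp [simp]: "dpar i (swp i J) = dpar i J"
  by (simp add: dpar_def fun_eq_iff)

lemma dyn_Suc: "dyn J l (Suc i) = dpar i J (J (Suc i)) - dpar i J (Suc l)"
  by (simp add: dyn_def dpar_def Cnum_def cnt_def)

lemma dyn_at:
  assumes "i < n"
  shows "dyn J l i = dpar i J (J i) - dpar i J (Suc l)
    - (if J (Suc i) = J i then 1 else 0) + (if J (Suc i) = Suc l then 1 else 0)"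
  unfolding dyn_def dpar_def Cnum_def card_greater_Suc[OF assms] by simp

lemma fac_Suc: "fac l J y w (Suc i) = \<phi> (w (Suc i) - y (Suc i)) (dyn J l (Suc i)) * tail i l J y w (y (Suc i))"
  by (simp add: fac_def tail_def)

lemma fac_at:
  assumes "i < n" "J (Suc i) \<le> Suc l"
  shows "fac l J y w i = \<phi> (w i - y i) (dyn J l i) * \<gamma> (w (Suc i) - y i) *
    (if J (Suc i) \<le> l then \<eta> (y i - y (Suc i)) else 1) * tail i l J y w (y i)"
proof -
  have up: "{s' \<in> Jset J n k. i < s'} = (if J (Suc i) \<le> k then insert (Suc i) {s' \<in> Jset J n k. Suc i < s'} else {s' \<in> Jset J n k. Suc i < s'})" for k
    using assms(1) by (auto simp: Jset_iff less_Suc_eq_le) (metis le_neq_implies_less Suc_leI)+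
  show ?thesis
    unfolding fac_def up tail_def using assms(2) by (auto simp: mult_ac)
qed

lemma f_S_Suc: "s \<in> S \<Longrightarrow> t \<in> S \<Longrightarrow> f (s - t + 1) \<noteq> 0"
  using f_S[of s t 1] f_int[of 1] by (cases "s = t") auto

lemma f_dpar:
  assumes "a \<in> {1..N}" "b \<in> {1..N}" "a \<noteq> b"
  shows "f (dpar i J a - dpar i J b + of_int m) \<noteq> 0"
proof -
  have "dpar i J a - dpar i J b + of_int m = P' a - P' b + of_int (m - int (cnt n i J a) + int (cnt n i J b))"
    by (simp add: dpar_def)
  then show ?thesis using f_P[OF assms] by presburger
qed

definition outer :: "nat \<Rightarrow> nat \<Rightarrow> (nat \<Rightarrow> nat) \<Rightarrow> (nat \<Rightarrow> complex) \<Rightarrow> (nat \<Rightarrow> complex) \<Rightarrow> complex" where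
  "outer i l J y w = (\<Prod>s\<in>Jset J n l - {i, Suc i}. fac l J y w s) * tail i l J y w (y i) * tail i l J y w (y (Suc i))"

lemma blk_outer:
  assumes i: "i \<in> {1..<n}" and J: "J i \<le> l" "J (Suc i) \<le> l"
  shows "blk l J y w = outer i l J y w * \<Phi> (dyn J l i) (dyn J l (Suc i)) (y i) (y (Suc i)) (w i) (w (Suc i))"
proof -
  have "Jset J n l = insert i (insert (Suc i) (Jset J n l - {i, Suc i}))"
    using i J by (auto simp: Jset_iff)
  then have "blk l J y w = fac l J y w i * (fac l J y w (Suc i) * (\<Prod>s\<in>Jset J n l - {i, Suc i}. fac l J y w s))"
    unfolding blk_def by (metis (no_types, lifting) Diff_iff finite_Diff finite_Jset finite_insert insertCI insertE n_not_Suc_n prod.insert)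
  then show ?thesis
    using i J fac_at[of i J l y w] by (simp add: fac_Suc outer_def \<Phi>_def mult_ac)
qed

lemma outer_swp:
  assumes i: "i \<in> {1..<n}" and J: "J i \<le> l" "J (Suc i) \<le> l"
  shows "outer i l J (swp i y) w = outer i l J y w" "outer i l J y (swp i w) = outer i l J y w"
    "outer i l (swp i J) y w = outer i l J y w"
proof -
  have J': "J i \<le> Suc l" "J (Suc i) \<le> Suc l" using J by simp_all
  show "outer i l J (swp i y) w = outer i l J y w" "outer i l J y (swp i w) = outer i l J y w"
    by (simp_all add: outer_def tail_swp fac_swp_bottom[OF i J] fac_swp_top[OF i J'])
  have "Jset (swp i J) n l = Jset J n l"
    using Jset_swp[OF i] adj_Jset[OF i] J by simp
  then show "outer i l (swp i J) y w = outer i l J y w"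
    by (simp add: outer_def tail_swp fac_swp_colours[OF i J])
qed

lemma G_exchange:
  assumes i: "i \<in> {1..<n}" and J: "J \<in> {1..n} \<rightarrow> {1..N}" and l: "l \<le> N"
    and w: "w i \<in> S" "w (Suc i) \<in> S" "w i \<noteq> w (Suc i)"
  shows "(J i = J (Suc i) \<and> J i \<le> l \<longrightarrow> G l J (swp i w) = G l J w) \<and>
    (J i < J (Suc i) \<and> J (Suc i) \<le> l \<longrightarrow>
       G l J w = G l J (swp i w) * \<kappa> (w (Suc i) - w i) (dpar i J (J i) - dpar i J (J (Suc i)))
         + G l (swp i J) (swp i w) * \<gamma> (w (Suc i) - w i))"
  using l w
proof (induction l arbitrary: w)
  case 0
  have "J i \<ge> 1" "J (Suc i) \<ge> 1" using i J by (auto simp: Pi_iff)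
  then show ?case by auto
next
  case (Suc l)
  have in1: "i \<in> {1..n}" "Suc i \<in> {1..n}" "i < n" using i by auto
  have JN: "J i \<in> {1..N}" "J (Suc i) \<in> {1..N}" using in1 J by (auto simp: Pi_iff)
  define x where "x = w (Suc i) - w i"
  have x1: "f (w (Suc i) - w i + 1) \<noteq> 0" using Suc.prems f_S_Suc by blast
  let ?B = "Bij (Jset J n l) (T l)"
  have yS: "y s \<in> S" if "y \<in> ?B" "s \<in> Jset J n l" for y s
    using that T_S[of l] by (auto simp: Bij_def bij_betw_def)
  have inner: "(y i \<in> S \<and> y (Suc i) \<in> S \<and> y i \<noteq> y (Suc i)) \<and>
      f (w i - y i + 1) \<noteq> 0 \<and> f (w (Suc i) - y i + 1) \<noteq> 0 \<and> f (w i - y (Suc i) + 1) \<noteq> 0 \<and> f (w (Suc i) - y (Suc i) + 1) \<noteq> 0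
      \<and> f (y (Suc i) - y i) \<noteq> 0 \<and> f (y (Suc i) - y i + 1) \<noteq> 0 \<and> f (y i - y (Suc i) + 1) \<noteq> 0"
    if y: "y \<in> ?B" and le: "J i \<le> l" "J (Suc i) \<le> l" for y
  proof -
    have m: "i \<in> Jset J n l" "Suc i \<in> Jset J n l" using in1 le by (auto simp: Jset_iff)
    then have "y i \<noteq> y (Suc i)" using y inj_onD[of y "Jset J n l" i "Suc i"] by (auto simp: Bij_def bij_betw_def)
    then show ?thesis
      using yS[OF y m(1)] yS[OF y m(2)] f_S[of "y (Suc i)" "y i" 0] Suc.prems f_S_Suc by auto
  qed
  have same: "G (Suc l) J (swp i w) = G (Suc l) J w" if eq: "J i = J (Suc i)" "J i \<le> Suc l"
  proof (cases "J i = Suc l")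
    case True
    have "blk l J y (swp i w) = blk l J y w" for y
      unfolding blk_def using True eq by (intro prod.cong refl fac_swp_top[OF i]) (auto simp: Jset_iff)
    then show ?thesis by simp
  next
    case False
    then have le: "J i \<le> l" "J (Suc i) \<le> l" using eq by auto
    define b where "b = dpar i J (J i) - dpar i J (Suc l)"
    have d: "dyn J l (Suc i) = b" "dyn J l i = b - 1"
      using eq False by (simp_all add: dyn_Suc dyn_at[OF in1(3)] b_def)
    have nz: "f b \<noteq> 0" "f (b - 1) \<noteq> 0"
      using f_dpar[of "J i" "Suc l" i J 0] f_dpar[of "J i" "Suc l" i J "-1"] JN Suc.prems(1) False
      unfolding b_def by auto
    have A: "adj i ` Jset J n l = Jset J n l" by (rule adj_Jset[OF i]) (use le in simp)
    have "2 * G (Suc l) J (swp i w) = (\<Sum>y\<in>?B. blk l J y (swp i w) * G l J y + blk l J (swp i y) (swp i w) * G l J (swp i y))"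
      by (simp add: sum_Bij_symmetrize[OF A])
    also have "\<dots> = (\<Sum>y\<in>?B. blk l J y w * G l J y + blk l J (swp i y) w * G l J (swp i y))"
    proof (rule sum.cong[OF refl])
      fix y assume y: "y \<in> ?B"
      note yy = inner[OF y le]
      have g: "G l J (swp i y) = G l J y" using Suc.IH[of y] Suc.prems yy eq le by auto
      have "\<Phi> (b - 1) b (y i) (y (Suc i)) (w i) (w (Suc i)) + \<Phi> (b - 1) b (y (Suc i)) (y i) (w i) (w (Suc i)) =
        \<Phi> (b - 1) b (y i) (y (Suc i)) (w (Suc i)) (w i) + \<Phi> (b - 1) b (y (Suc i)) (y i) (w (Suc i)) (w i)"
        by (rule exchange_same) (use yy nz x1 in auto)
      then show "blk l J y (swp i w) * G l J y + blk l J (swp i y) (swp i w) * G l J (swp i y) =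
          blk l J y w * G l J y + blk l J (swp i y) w * G l J (swp i y)"
        unfolding g blk_outer[OF i le] outer_swp[OF i le] d swp_left swp_right
        by (simp add: distrib_left[symmetric] distrib_right[symmetric])
    qed
    also have "\<dots> = 2 * G (Suc l) J w"
      by (simp add: sum_Bij_symmetrize[OF A])
    finally show ?thesis by simp
  qed
  define D where "D = dpar i J (J i) - dpar i J (J (Suc i))"
  have asc: "G (Suc l) J w = G (Suc l) J (swp i w) * \<kappa> (w (Suc i) - w i) D + G (Suc l) (swp i J) (swp i w) * \<gamma> (w (Suc i) - w i)"
    if lt: "J i < J (Suc i)" "J (Suc i) \<le> Suc l"
  proof (cases "J (Suc i) = Suc l")
    case True
    then have le: "J i \<le> l" "\<not> J (Suc i) \<le> l" using lt by auto
    have m: "i \<in> Jset J n l" "Suc i \<notin> Jset J n l" using in1 le by (auto simp: Jset_iff)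
    have d: "dyn J l i = D + 1" "dyn (swp i J) l (Suc i) = D"
      using True le by (simp_all add: dyn_Suc dyn_at[OF in1(3)] D_def)
    have nz: "f D \<noteq> 0" "f (D + 1) \<noteq> 0"
      using f_dpar[of "J i" "J (Suc i)" i J 0] f_dpar[of "J i" "J (Suc i)" i J 1] JN lt unfolding D_def by auto
    have main: "blk l J y w = blk l J y (swp i w) * \<kappa> (w (Suc i) - w i) D
        + blk l (swp i J) (swp i y) (swp i w) * \<gamma> (w (Suc i) - w i)" if y: "y \<in> ?B" for y
    proof -
      let ?R = "\<Prod>s\<in>Jset J n l - {i}. fac l J y w s"
      have yi: "y i \<in> S" using yS[OF y m(1)] .
      have rest: "s \<notin> {i, Suc i}" if "s \<in> Jset J n l - {i}" for s using that m by auto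
      have 1: "blk l J y w = fac l J y w i * ?R"
        unfolding blk_def using m by (simp add: prod.remove)
      have "blk l J y (swp i w) = fac l J y (swp i w) i * (\<Prod>s\<in>Jset J n l - {i}. fac l J y (swp i w) s)"
        unfolding blk_def using m by (simp add: prod.remove)
      also have "(\<Prod>s\<in>Jset J n l - {i}. fac l J y (swp i w) s) = ?R"
        using rest lt by (intro prod.cong refl fac_swp_top[OF i]) auto
      finally have 2: "blk l J y (swp i w) = fac l J y (swp i w) i * ?R" .
      have "blk l (swp i J) (swp i y) (swp i w) = (\<Prod>s\<in>Jset J n l. fac l (swp i J) (swp i y) (swp i w) (adj i s))"
        unfolding blk_def Jset_swp[OF i] by (subst prod.reindex) (auto simp: inj_on_adj)
      also have "\<dots> = fac l (swp i J) (swp i y) (swp i w) (Suc i) *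
          (\<Prod>s\<in>Jset J n l - {i}. fac l (swp i J) (swp i y) (swp i w) (adj i s))"
        using m by (simp add: prod.remove)
      also have "(\<Prod>s\<in>Jset J n l - {i}. fac l (swp i J) (swp i y) (swp i w) (adj i s)) = ?R"
        using rest by (intro prod.cong refl fac_relabel[OF i]) auto
      finally have 3: "blk l (swp i J) (swp i y) (swp i w) = fac l (swp i J) (swp i y) (swp i w) (Suc i) * ?R" .
      have "\<phi> (w i - y i) (D + 1) * \<gamma> (w (Suc i) - y i) =
          \<phi> (w (Suc i) - y i) (D + 1) * \<gamma> (w i - y i) * \<kappa> (w (Suc i) - w i) D + \<phi> (w i - y i) D * \<gamma> (w (Suc i) - w i)"
        using exchange_one[of "w i - y i" "w (Suc i) - y i" D] nz x1 f_S_Suc[OF Suc.prems(2) yi] f_S_Suc[OF Suc.prems(3) yi]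
        by simp
      then have "fac l J y w i = fac l J y (swp i w) i * \<kappa> (w (Suc i) - w i) D
          + fac l (swp i J) (swp i y) (swp i w) (Suc i) * \<gamma> (w (Suc i) - w i)"
        using lt le by (simp add: fac_at[OF in1(3)] fac_Suc d tail_swp) (simp add: algebra_simps)
      then show ?thesis unfolding 1 2 3 by (simp add: algebra_simps)
    qed
    have "G (Suc l) (swp i J) (swp i w) = (\<Sum>y\<in>?B. blk l (swp i J) (swp i y) (swp i w) * G l (swp i J) (swp i y))"
      by (simp add: Jset_swp[OF i] sum_Bij_swp)
    also have "\<dots> = (\<Sum>y\<in>?B. blk l (swp i J) (swp i y) (swp i w) * G l J y)"
      using le by (simp add: G_relabel[OF i])
    finally have "G (Suc l) J (swp i w) * \<kappa> (w (Suc i) - w i) D + G (Suc l) (swp i J) (swp i w) * \<gamma> (w (Suc i) - w i) =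
      (\<Sum>y\<in>?B. (blk l J y (swp i w) * \<kappa> (w (Suc i) - w i) D
        + blk l (swp i J) (swp i y) (swp i w) * \<gamma> (w (Suc i) - w i)) * G l J y)"
      by (simp add: sum_distrib_left sum_distrib_right sum.distrib algebra_simps)
    also have "\<dots> = G (Suc l) J w" using main by simp
    finally show ?thesis by simp
  next
    case False
    then have le: "J i \<le> l" "J (Suc i) \<le> l" using lt by auto
    then have le': "swp i J i \<le> l" "swp i J (Suc i) \<le> l" by simp_all
    define a b where "a = dpar i J (J i) - dpar i J (Suc l)" and "b = dpar i J (J (Suc i)) - dpar i J (Suc l)"
    have Dab: "D = a - b" by (simp add: D_def a_def b_def)
    have d: "dyn J l i = a" "dyn J l (Suc i) = b" "dyn (swp i J) l i = b" "dyn (swp i J) l (Suc i) = a"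
      using lt le by (simp_all add: dyn_Suc dyn_at[OF in1(3)] a_def b_def)
    have nz: "f a \<noteq> 0" "f b \<noteq> 0" "f (a - b) \<noteq> 0"
      using f_dpar[of "J i" "Suc l" i J 0] f_dpar[of "J (Suc i)" "Suc l" i J 0] f_dpar[of "J i" "J (Suc i)" i J 0]
        JN Suc.prems(1) le lt unfolding a_def b_def by auto
    have A: "adj i ` Jset J n l = Jset J n l" by (rule adj_Jset[OF i]) (use le in simp)
    let ?k = "\<kappa> (w (Suc i) - w i) D" and ?g = "\<gamma> (w (Suc i) - w i)"
    have pair: "blk l J y w * G l J y + blk l J (swp i y) w * G l J (swp i y) =
        (blk l J y (swp i w) * G l J y + blk l J (swp i y) (swp i w) * G l J (swp i y)) * ?k +
        (blk l (swp i J) y (swp i w) * G l (swp i J) y + blk l (swp i J) (swp i y) (swp i w) * G l (swp i J) (swp i y)) * ?g"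
      if y: "y \<in> ?B" for y
    proof -
      note yy = inner[OF y le]
      have g: "G l J y = G l J (swp i y) * \<kappa> (y (Suc i) - y i) (a - b) + G l (swp i J) (swp i y) * \<gamma> (y (Suc i) - y i)"
        using Suc.IH[of y] Suc.prems yy lt le unfolding D_def[symmetric] Dab by auto
      have g': "G l J (swp i y) = G l J y * \<kappa> (y i - y (Suc i)) (a - b) + G l (swp i J) y * \<gamma> (y i - y (Suc i))"
        using Suc.IH[of "swp i y"] Suc.prems yy lt le unfolding D_def[symmetric] Dab by auto
      have "\<Phi> a b (y i) (y (Suc i)) (w i) (w (Suc i)) * G l J y + \<Phi> a b (y (Suc i)) (y i) (w i) (w (Suc i)) * G l J (swp i y) =
        (\<Phi> a b (y i) (y (Suc i)) (w (Suc i)) (w i) * G l J y + \<Phi> a b (y (Suc i)) (y i) (w (Suc i)) (w i) * G l J (swp i y)) * ?k +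
        (\<Phi> b a (y i) (y (Suc i)) (w (Suc i)) (w i) * G l (swp i J) y + \<Phi> b a (y (Suc i)) (y i) (w (Suc i)) (w i) * G l (swp i J) (swp i y)) * ?g"
        unfolding Dab by (rule exchange_two[OF _ _ _ _ _ _ _ _ nz g g']) (use yy x1 in auto)
      from arg_cong[OF this, of "\<lambda>t. outer i l J y w * t"] show ?thesis
        unfolding blk_outer[OF i le] blk_outer[OF i le'] outer_swp[OF i le] d swp_left swp_right
        by (simp add: algebra_simps)
    qed
    have "2 * G (Suc l) J w = (\<Sum>y\<in>?B. blk l J y w * G l J y + blk l J (swp i y) w * G l J (swp i y))"
      by (simp add: sum_Bij_symmetrize[OF A])
    also have "\<dots> = (\<Sum>y\<in>?B. (blk l J y (swp i w) * G l J y + blk l J (swp i y) (swp i w) * G l J (swp i y)) * ?k +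
        (blk l (swp i J) y (swp i w) * G l (swp i J) y + blk l (swp i J) (swp i y) (swp i w) * G l (swp i J) (swp i y)) * ?g)"
      by (rule sum.cong[OF refl pair])
    also have "\<dots> = 2 * G (Suc l) J (swp i w) * ?k + 2 * G (Suc l) (swp i J) (swp i w) * ?g"
      by (simp add: sum.distrib sum_distrib_right[symmetric] sum_Bij_symmetrize[OF A] Jset_swp[OF i] A)
    also have "\<dots> = 2 * (G (Suc l) J (swp i w) * ?k + G (Suc l) (swp i J) (swp i w) * ?g)"
      by (simp only: distrib_left mult.assoc)
    finally have "2 * G (Suc l) J w = 2 * (G (Suc l) J (swp i w) * ?k + G (Suc l) (swp i J) (swp i w) * ?g)" .
    then show ?thesis by (rule mult_left_cancel[THEN iffD1, rotated]) simp
  qed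
  show ?case using same asc unfolding D_def by blast
qed

end

section \<open>Comparison with the symmetrized weight function\<close>

lemma bij_betw_jidx: "bij_betw (jidx J n l) {1..card (Jset J n l)} (Jset J n l)"
proof -
  have "bij_betw ((!) (sorted_list_of_set (Jset J n l))) {..<card (Jset J n l)} (Jset J n l)"
    by (rule bij_betw_nth) simp_all
  moreover have "bij_betw (\<lambda>a. a - 1) {1..card (Jset J n l)} {..<card (Jset J n l)}"
    by (rule bij_betw_byWitness[where f' = Suc]) auto
  ultimately show ?thesis
    using bij_betw_trans unfolding jidx_def by (fastforce simp: o_def)
qed

lemma jidx_less_iff:
  assumes "a \<in> {1..card (Jset J n l)}" "b \<in> {1..card (Jset J n l)}"
  shows "jidx J n l a < jidx J n l b \<longleftrightarrow> a < b"
proof -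
  have less: "jidx J n l a < jidx J n l b"
    if "a < b" "a \<in> {1..card (Jset J n l)}" "b \<in> {1..card (Jset J n l)}" for a b
    unfolding jidx_def
    by (rule sorted_wrt_nth_less[OF strict_sorted_list_of_set]) (use that in auto)
  show ?thesis using less[of a b] less[of b a] assms by (metis less_asym' nat_neq_iff)
qed

lemma bij_betw_Collect: "bij_betw h A B \<Longrightarrow> bij_betw h {a \<in> A. Q (h a)} {b \<in> B. Q b}"
  by (auto simp: bij_betw_def inj_on_def)

lemma sum_permutes_Bij:
  assumes e: "bij_betw e {1..k} A" and v: "bij_betw v {1..k} T"
  shows "(\<Sum>\<pi> | \<pi> permutes {1..k}. X (\<lambda>s\<in>A. v (\<pi> (inv_into {1..k} e s)))) = (\<Sum>y\<in>Bij A T. X y)"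
proof (rule sum.reindex_bij_witness[of _ "\<lambda>y a. if a \<in> {1..k} then inv_into {1..k} v (y (e a)) else a"
      "\<lambda>\<pi>. \<lambda>s\<in>A. v (\<pi> (inv_into {1..k} e s))"])
  have ei: "bij_betw (inv_into {1..k} e) A {1..k}" and vi: "bij_betw (inv_into {1..k} v) T {1..k}"
    using e v by (auto intro: bij_betw_inv_into)
  note in_A = bij_betwE[OF e] and in_T = bij_betwE[OF v] and in_k = bij_betwE[OF ei]
  note inv_e = bij_betw_inv_into_left[OF e] and inv_e' = bij_betw_inv_into_right[OF e]
  note inv_v = bij_betw_inv_into_left[OF v] and inv_v' = bij_betw_inv_into_right[OF v]
  {
    fix \<pi> assume "\<pi> \<in> {\<pi>. \<pi> permutes {1..k}}"
    then have p: "\<pi> permutes {1..k}" by simp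
    show "(\<lambda>a. if a \<in> {1..k} then inv_into {1..k} v ((\<lambda>s\<in>A. v (\<pi> (inv_into {1..k} e s))) (e a)) else a) = \<pi>"
    proof
      fix a show "(if a \<in> {1..k} then inv_into {1..k} v ((\<lambda>s\<in>A. v (\<pi> (inv_into {1..k} e s))) (e a)) else a) = \<pi> a"
        using p in_A[THEN bspec, of a] inv_e[of a] inv_v[of "\<pi> a"] permutes_in_image[OF p, of a] permutes_not_in[OF p, of a] by (auto simp del: atLeastAtMost_iff)
    qed
    have "bij_betw (v \<circ> (\<pi> \<circ> inv_into {1..k} e)) A T"
      using ei permutes_imp_bij[OF p] v by (blast intro: bij_betw_trans)
    then have "bij_betw (\<lambda>s\<in>A. v (\<pi> (inv_into {1..k} e s))) A T"
      by (subst bij_betw_cong[of A _ "v \<circ> (\<pi> \<circ> inv_into {1..k} e)"]) auto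
    then show "(\<lambda>s\<in>A. v (\<pi> (inv_into {1..k} e s))) \<in> Bij A T"
      by (simp add: Bij_def)
  next
    fix y assume "y \<in> Bij A T"
    then have ex: "y \<in> extensional A" and y: "bij_betw y A T" by (auto simp: Bij_def)
    note y_T = bij_betwE[OF y]
    have "bij_betw (inv_into {1..k} v \<circ> (y \<circ> e)) {1..k} {1..k}"
      using e y vi by (blast intro: bij_betw_trans)
    then have "bij_betw (\<lambda>a. if a \<in> {1..k} then inv_into {1..k} v (y (e a)) else a) {1..k} {1..k}"
      by (subst bij_betw_cong[of "{1..k}" _ "inv_into {1..k} v \<circ> (y \<circ> e)"]) auto
    then show "(\<lambda>a. if a \<in> {1..k} then inv_into {1..k} v (y (e a)) else a) \<in> {\<pi>. \<pi> permutes {1..k}}"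
      by (intro CollectI bij_imp_permutes) auto
    show "(\<lambda>s\<in>A. v (if inv_into {1..k} e s \<in> {1..k} then inv_into {1..k} v (y (e (inv_into {1..k} e s)))
        else inv_into {1..k} e s)) = y"
    proof
      fix s show "(\<lambda>s\<in>A. v (if inv_into {1..k} e s \<in> {1..k} then inv_into {1..k} v (y (e (inv_into {1..k} e s)))
        else inv_into {1..k} e s)) s = y s"
      proof (cases "s \<in> A")
        case True
        then have "inv_into {1..k} e s \<in> {1..k}" "e (inv_into {1..k} e s) = s" "y s \<in> T"
          using in_k inv_e' y_T by blast+
        then show ?thesis using True inv_v'[of "y s"] by simp
      next
        case False
        then show ?thesis using extensional_arb[OF ex False] by simp
      qed
    qed
  }
qed simp

context weight_function
begin

definition blk_idx :: "nat \<Rightarrow> (nat \<Rightarrow> nat) \<Rightarrow> (nat \<Rightarrow> nat) \<Rightarrow> (nat \<Rightarrow> complex) \<Rightarrow> (nat \<Rightarrow> complex) \<Rightarrow> complex" where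
  "blk_idx l k J v v' = (\<Prod>a\<in>{1..k l}.
      (let s = jidx J n l a;
           b0 = (THE b. b \<in> {1..k (Suc l)} \<and> jidx J n (Suc l) b = s);
           d = P' (J s) - P' (Suc l) - of_int (Cnum J n l s) in
       f (v' b0 - v a + d) * f 1 / (f (v' b0 - v a + 1) * f d)
       * (\<Prod>b\<in>{b\<in>{1..k (Suc l)}. jidx J n (Suc l) b > s}. f (v' b - v a) / f (v' b - v a + 1))
       * (\<Prod>b\<in>{a<..k l}. f (v a - v b - 1) / f (v a - v b))))"

lemma blk_idx_eq_blk:
  assumes k: "k l = card (Jset J n l)" "k (Suc l) = card (Jset J n (Suc l))"
    and y: "\<And>a. a \<in> {1..k l} \<Longrightarrow> y (jidx J n l a) = v a"
    and w: "\<And>b. b \<in> {1..k (Suc l)} \<Longrightarrow> w (jidx J n (Suc l) b) = v' b"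
  shows "blk_idx l k J v v' = blk l J y w"
proof -
  have bij: "bij_betw (jidx J n l) {1..k l} (Jset J n l)" and bij': "bij_betw (jidx J n (Suc l)) {1..k (Suc l)} (Jset J n (Suc l))"
    unfolding k by (rule bij_betw_jidx)+
  have "blk l J y w = (\<Prod>a\<in>{1..k l}. fac l J y w (jidx J n l a))"
    unfolding blk_def by (rule prod.reindex_bij_betw[OF bij, symmetric])
  also have "\<dots> = blk_idx l k J v v'"
    unfolding blk_idx_def
  proof (rule prod.cong[OF refl])
    fix a assume a: "a \<in> {1..k l}"
    define s where "s = jidx J n l a"
    have s: "s \<in> Jset J n l" using bij_betwE[OF bij] a by (simp add: s_def)
    then have "s \<in> Jset J n (Suc l)" by (auto simp: Jset_iff)
    then have "s \<in> jidx J n (Suc l) ` {1..k (Suc l)}"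
      unfolding bij_betw_imp_surj_on[OF bij'] .
    then obtain b0 where b0: "b0 \<in> {1..k (Suc l)}" "jidx J n (Suc l) b0 = s" by blast
    have the: "(THE b. b \<in> {1..k (Suc l)} \<and> jidx J n (Suc l) b = s) = b0"
    proof (rule the_equality)
      show "b \<in> {1..k (Suc l)} \<and> jidx J n (Suc l) b = s \<Longrightarrow> b = b0" for b
        using inj_onD[OF bij_betw_imp_inj_on[OF bij'], of b b0] b0 by metis
    qed (use b0 in blast)
    have b1: "bij_betw (jidx J n (Suc l)) {b\<in>{1..k (Suc l)}. jidx J n (Suc l) b > s} {s' \<in> Jset J n (Suc l). s < s'}"
      by (rule bij_betw_Collect[OF bij'])
    have p1: "(\<Prod>s'\<in>{s' \<in> Jset J n (Suc l). s < s'}. \<gamma> (w s' - y s)) =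
        (\<Prod>b\<in>{b\<in>{1..k (Suc l)}. jidx J n (Suc l) b > s}. f (v' b - v a) / f (v' b - v a + 1))"
      unfolding prod.reindex_bij_betw[OF b1, symmetric]
    proof (rule prod.cong[OF refl])
      fix b assume "b \<in> {b\<in>{1..k (Suc l)}. jidx J n (Suc l) b > s}"
      then show "\<gamma> (w (jidx J n (Suc l) b) - y s) = f (v' b - v a) / f (v' b - v a + 1)"
        using w[of b] y[OF a] by (simp add: \<gamma>_def s_def)
    qed
    have "{a<..k l} = {b \<in> {1..k l}. s < jidx J n l b}"
      using jidx_less_iff[of a J n l] a unfolding s_def k(1)[symmetric] by auto
    then have b2: "bij_betw (jidx J n l) {a<..k l} {s' \<in> Jset J n l. s < s'}"
      using bij_betw_Collect[OF bij, of "\<lambda>s'. s < s'"] by simp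
    have p2: "(\<Prod>s'\<in>{s' \<in> Jset J n l. s < s'}. \<eta> (y s - y s')) =
        (\<Prod>b\<in>{a<..k l}. f (v a - v b - 1) / f (v a - v b))"
      unfolding prod.reindex_bij_betw[OF b2, symmetric]
    proof (rule prod.cong[OF refl])
      fix b assume "b \<in> {a<..k l}"
      then have "b \<in> {1..k l}" using a by auto
      then show "\<eta> (y s - y (jidx J n l b)) = f (v a - v b - 1) / f (v a - v b)"
        using y[of b] y[OF a] by (simp add: \<eta>_def s_def)
    qed
    show "fac l J y w (jidx J n l a) = (let s = jidx J n l a;
           b0 = (THE b. b \<in> {1..k (Suc l)} \<and> jidx J n (Suc l) b = s);
           d = P' (J s) - P' (Suc l) - of_int (Cnum J n l s) in
       f (v' b0 - v a + d) * f 1 / (f (v' b0 - v a + 1) * f d)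
       * (\<Prod>b\<in>{b\<in>{1..k (Suc l)}. jidx J n (Suc l) b > s}. f (v' b - v a) / f (v' b - v a + 1))
       * (\<Prod>b\<in>{a<..k l}. f (v a - v b - 1) / f (v a - v b)))"
      unfolding Let_def s_def[symmetric] the fac_def p1 p2 \<phi>_def dyn_def
      using w[OF b0(1)] y[OF a] by (simp add: b0(2) s_def[symmetric])
  qed
  finally show ?thesis ..
qed

lemma sum_PiE_chain_eq_G:
  assumes J: "Jset J n 0 = {}" and T0: "T 0 = {}"
    and k: "\<And>l. l \<le> M \<Longrightarrow> k l = card (Jset J n l)"
    and v: "\<And>l. l \<in> {1..<M} \<Longrightarrow> bij_betw (v l) {1..k l} (T l)"
    and m: "m < M"
    and w: "\<And>b. b \<in> {1..k (Suc m)} \<Longrightarrow> w (jidx J n (Suc m) b) = x b"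
  shows "(\<Sum>\<sigma>\<in>(\<Pi>\<^sub>E l\<in>{1..m}. {\<pi>. \<pi> permutes {1..k l}}). \<Prod>l\<in>{1..m}.
      blk_idx l k J (\<lambda>a. v l (\<sigma> l a)) (if l = m then x else (\<lambda>a. v (Suc l) (\<sigma> (Suc l) a)))) = G (Suc m) J w"
  using m w
proof (induction m arbitrary: w x)
  case 0
  have "Bij {} ({} :: complex set) = {\<lambda>s. undefined}" by (auto simp: Bij_def bij_betw_def)
  then show ?case by (simp add: J T0 blk_def)
next
  case (Suc m)
  let ?S = "\<lambda>l. {\<pi>. \<pi> permutes {1..k l}}"
  let ?F = "\<lambda>\<sigma> m x. \<Prod>l\<in>{1..m}. blk_idx l k J (\<lambda>a. v l (\<sigma> l a)) (if l = m then x else (\<lambda>a. v (Suc l) (\<sigma> (Suc l) a)))"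
  let ?A = "Jset J n (Suc m)" and ?e = "jidx J n (Suc m)"
  have kS: "k (Suc m) = card ?A" using k[of "Suc m"] Suc.prems by simp
  have e: "bij_betw ?e {1..k (Suc m)} ?A" unfolding kS by (rule bij_betw_jidx)
  have T: "bij_betw (v (Suc m)) {1..k (Suc m)} (T (Suc m))" using v[of "Suc m"] Suc.prems by simp
  have F: "?F (g(Suc m := \<pi>)) (Suc m) x = blk_idx (Suc m) k J (\<lambda>a. v (Suc m) (\<pi> a)) x * ?F g m (\<lambda>a. v (Suc m) (\<pi> a))"
    for g \<pi>
  proof -
    have "(\<Prod>l\<in>{1..m}. blk_idx l k J (\<lambda>a. v l ((g(Suc m := \<pi>)) l a))
         (if l = Suc m then x else (\<lambda>a. v (Suc l) ((g(Suc m := \<pi>)) (Suc l) a)))) = ?F g m (\<lambda>a. v (Suc m) (\<pi> a))"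
      by (intro prod.cong refl) (auto simp: fun_eq_iff intro!: arg_cong2[where f = "blk_idx _ k J"])
    then show ?thesis by (simp add: mult.commute)
  qed
  have "(\<Sum>\<sigma>\<in>(\<Pi>\<^sub>E l\<in>{1..Suc m}. ?S l). ?F \<sigma> (Suc m) x) =
      (\<Sum>(\<pi>, g)\<in>?S (Suc m) \<times> (\<Pi>\<^sub>E l\<in>{1..m}. ?S l). ?F (g(Suc m := \<pi>)) (Suc m) x)"
  proof -
    have ins: "{1..Suc m} = insert (Suc m) {1..m}" by auto
    show ?thesis
      unfolding ins PiE_insert_eq by (subst sum.reindex[OF inj_combinator]) (auto simp: case_prod_unfold intro!: sum.cong)
  qed
  also have "\<dots> = (\<Sum>\<pi>\<in>?S (Suc m). \<Sum>g\<in>(\<Pi>\<^sub>E l\<in>{1..m}. ?S l).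
      blk_idx (Suc m) k J (\<lambda>a. v (Suc m) (\<pi> a)) x * ?F g m (\<lambda>a. v (Suc m) (\<pi> a)))"
    unfolding F by (rule sum.cartesian_product[symmetric])
  also have "\<dots> = (\<Sum>\<pi>\<in>?S (Suc m). blk_idx (Suc m) k J (\<lambda>a. v (Suc m) (\<pi> a)) x *
      (\<Sum>g\<in>(\<Pi>\<^sub>E l\<in>{1..m}. ?S l). ?F g m (\<lambda>a. v (Suc m) (\<pi> a))))"
    by (simp only: sum_distrib_left)
  also have "\<dots> = (\<Sum>\<pi>\<in>?S (Suc m). (\<lambda>y. blk (Suc m) J y w * G (Suc m) J y)
      (\<lambda>s\<in>?A. v (Suc m) (\<pi> (inv_into {1..k (Suc m)} ?e s))))"
  proof (rule sum.cong[OF refl])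
    fix \<pi> assume "\<pi> \<in> ?S (Suc m)"
    let ?y = "\<lambda>s\<in>?A. v (Suc m) (\<pi> (inv_into {1..k (Suc m)} ?e s))"
    have y: "?y (?e a) = v (Suc m) (\<pi> a)" if "a \<in> {1..k (Suc m)}" for a
      using that bij_betwE[OF e] bij_betw_inv_into_left[OF e] by simp
    have "(\<Sum>g\<in>(\<Pi>\<^sub>E l\<in>{1..m}. ?S l). ?F g m (\<lambda>a. v (Suc m) (\<pi> a))) = G (Suc m) J ?y"
      by (rule Suc.IH) (use Suc.prems y in auto)
    moreover have "blk_idx (Suc m) k J (\<lambda>a. v (Suc m) (\<pi> a)) x = blk (Suc m) J ?y w"
      by (rule blk_idx_eq_blk) (use Suc.prems k y in auto)
    ultimately show "blk_idx (Suc m) k J (\<lambda>a. v (Suc m) (\<pi> a)) x *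
      (\<Sum>g\<in>(\<Pi>\<^sub>E l\<in>{1..m}. ?S l). ?F g m (\<lambda>a. v (Suc m) (\<pi> a))) = (\<lambda>y. blk (Suc m) J y w * G (Suc m) J y) ?y"
      by simp
  qed
  also have "\<dots> = G (Suc (Suc m)) J w"
    by (subst sum_permutes_Bij[OF e T]) simp
  finally show ?case .
qed

end

section \<open>The antitone initial sequence\<close>

lemma finite_Bij: "finite A \<Longrightarrow> finite (Bij A T)"
proof (cases "Bij A T = {}")
  case False
  assume A: "finite A"
  from False obtain y where "bij_betw y A T" by (auto simp: Bij_def)
  then have "finite T" using A bij_betw_finite by blast
  moreover have "Bij A T \<subseteq> (\<Pi>\<^sub>E a\<in>A. T)"
    by (auto simp: Bij_def PiE_def dest: bij_betwE)
  ultimately show ?thesis using A by (meson finite_PiE finite_subset)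
qed simp

lemma card_colours:
  assumes "K \<in> Iset N n lam" "C \<subseteq> {1..N}"
  shows "card {s \<in> {1..n}. K s \<in> C} = (\<Sum>c\<in>C. lam c)"
proof -
  have "{s \<in> {1..n}. K s \<in> C} = (\<Union>c\<in>C. {s \<in> {1..n}. K s = c})" by auto
  also have "card \<dots> = (\<Sum>c\<in>C. card {s \<in> {1..n}. K s = c})"
    using finite_subset[OF assms(2)] by (intro card_UN_disjoint) auto
  also have "\<dots> = (\<Sum>c\<in>C. lam c)"
    using assms by (intro sum.cong) (auto simp: Iset_def)
  finally show ?thesis .
qed

lemma Iset_range: "K \<in> Iset N n lam \<Longrightarrow> s \<in> {1..n} \<Longrightarrow> K s \<in> {1..N}"
  unfolding Iset_def seqs_def by (blast dest: PiE_mem)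

lemma card_Jset:
  assumes "K \<in> Iset N n lam" "l \<le> N"
  shows "card (Jset K n l) = lamc lam l"
proof -
  have "Jset K n l = {s \<in> {1..n}. K s \<in> {1..l}}"
    using Iset_range[OF assms(1)] by (fastforce simp: Jset_def)
  then show ?thesis using card_colours[OF assms(1), of "{1..l}"] assms(2) by (simp add: lamc_def)
qed

lemma swp_Iset:
  assumes K: "K \<in> Iset N n lam" and i: "i \<in> {1..<n}"
  shows "swp i K \<in> Iset N n lam"
proof -
  have "K \<in> {1..n} \<rightarrow>\<^sub>E {1..N}" using K by (simp add: Iset_def seqs_def)
  then have "swp i K \<in> {1..n} \<rightarrow>\<^sub>E {1..N}"
    using i by (auto simp: PiE_iff swp_apply extensional_def)
  moreover have "card {s \<in> {1..n}. swp i K s = l} = card {s \<in> {1..n}. K s = l}" for l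
  proof -
    have "{s \<in> {1..n}. swp i K s = l} = adj i ` {s \<in> {1..n}. K s = l}"
    proof (intro equalityI subsetI)
      fix s assume "s \<in> {s \<in> {1..n}. swp i K s = l}"
      then have "adj i s \<in> {s \<in> {1..n}. K s = l}" using adj_in[OF i, of s] swp_adj[of i K "adj i s"] by simp
      then show "s \<in> adj i ` {s \<in> {1..n}. K s = l}" by (metis adj_adj imageI)
    next
      fix s assume "s \<in> adj i ` {s \<in> {1..n}. K s = l}"
      then obtain t where "s = adj i t" "t \<in> {1..n}" "K t = l" by blast
      then show "s \<in> {s \<in> {1..n}. swp i K s = l}" using adj_in[OF i, of t] by (simp add: swp_adj)
    qed
    then show ?thesis by (simp add: card_image inj_on_adj)
  qed
  ultimately show ?thesis using K by (simp add: Iset_def seqs_def)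
qed

lemma antitone_adjacent:
  assumes "\<And>i. i \<in> {1..<n} \<Longrightarrow> K (Suc i) \<le> (K i :: nat)" "1 \<le> s" "s \<le> t" "t \<le> n"
  shows "K t \<le> K s"
  using assms(3,4)
proof (induction t rule: dec_induct)
  case (step t)
  then have "K (Suc t) \<le> K t" using assms(1)[of t] assms(2) by simp
  then show ?case using step by simp
qed simp

lemma antitone_eq_Imax:
  assumes K: "K \<in> Iset N n lam" and anti: "\<And>i. i \<in> {1..<n} \<Longrightarrow> K (Suc i) \<le> K i"
  shows "K = Imax N n lam"
proof
  fix s
  show "K s = Imax N n lam s"
  proof (cases "s \<in> {1..n}")
    case True
    let ?P = "\<lambda>l. l \<in> {1..N} \<and> (\<Sum>k\<in>{l<..N}. lam k) < s \<and> s \<le> (\<Sum>k\<in>{l..N}. lam k)"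
    have mono: "K t \<le> K s'" if "1 \<le> s'" "s' \<le> t" "t \<le> n" for s' t
      using antitone_adjacent[of n K s' t] anti that by blast
    have r: "K s \<in> {1..N}" by (rule Iset_range[OF K True])
    have "{j \<in> {1..n}. K j \<in> {K s<..N}} \<subseteq> {1..<s}"
      using mono True by (force simp: not_le[symmetric])
    then have "card {j \<in> {1..n}. K j \<in> {K s<..N}} \<le> card {1..<s}"
      by (intro card_mono) auto
    then have 1: "(\<Sum>k\<in>{K s<..N}. lam k) < s"
      using True by (subst (asm) card_colours[OF K]) auto
    have "{1..s} \<subseteq> {j \<in> {1..n}. K j \<in> {K s..N}}"
    proof
      fix j assume j: "j \<in> {1..s}"
      then show "j \<in> {j \<in> {1..n}. K j \<in> {K s..N}}"
        using True mono[of j s] Iset_range[OF K, of j] by auto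
    qed
    then have "card {1..s} \<le> card {j \<in> {1..n}. K j \<in> {K s..N}}"
      by (intro card_mono) auto
    then have 2: "s \<le> (\<Sum>k\<in>{K s..N}. lam k)"
      using r by (subst (asm) card_colours[OF K]) auto
    have disjoint: False if "?P l" "?P l'" "l < l'" for l l'
    proof -
      have "(\<Sum>k\<in>{l'..N}. lam k) \<le> (\<Sum>k\<in>{l<..N}. lam k)"
        using that(3) by (intro sum_mono2) auto
      then show False using that by simp
    qed
    have "(THE l. ?P l) = K s"
    proof (rule the_equality)
      show P: "?P (K s)" using r 1 2 by simp
      show "l = K s" if "?P l" for l
        using disjoint[OF that P] disjoint[OF P that] nat_neq_iff by blast
    qed
    then show ?thesis unfolding Imax_def restrict_apply'[OF True] by (rule sym)
  next
    case False
    moreover have "K \<in> extensional {1..n}" using K by (simp add: Iset_def seqs_def PiE_def)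
    moreover have "Imax N n lam \<in> extensional {1..n}" by (simp add: Imax_def)
    ultimately show ?thesis using extensional_arb by metis
  qed
qed

lemma Iset_eqI:
  assumes J: "J \<in> Iset N n lam" and K: "K \<in> Iset N n lam" and eq: "\<And>l. l \<le> N \<Longrightarrow> Jset J n l = Jset K n l"
  shows "J = K"
proof
  fix s
  show "J s = K s"
  proof (cases "s \<in> {1..n}")
    case True
    then have "J s \<in> {1..N}" "K s \<in> {1..N}" using J K Iset_range by blast+
    then have "Jset J n (J s) = Jset K n (J s)" "Jset J n (K s) = Jset K n (K s)" using eq by simp_all
    moreover have "s \<in> Jset J n (J s)" "s \<in> Jset K n (K s)" using True by (simp_all add: Jset_iff)
    ultimately have "s \<in> Jset K n (J s)" "s \<in> Jset J n (K s)" by simp_all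
    then show ?thesis by (simp add: Jset_iff)
  next
    case False
    moreover have "J \<in> extensional {1..n}" "K \<in> extensional {1..n}"
      using J K by (simp_all add: Iset_def seqs_def PiE_def)
    ultimately show ?thesis using extensional_arb by metis
  qed
qed

context weight_function
begin

lemma \<phi>_0: "f d \<noteq> 0 \<Longrightarrow> \<phi> 0 d = 1"
  using f_int[of 1] by (simp add: \<phi>_def)

lemma \<gamma>_mult_\<eta>: "f x \<noteq> 0 \<Longrightarrow> f (x + 1) \<noteq> 0 \<Longrightarrow> \<gamma> x * \<eta> (- x) = 1"
  using minus[of x] minus[of "x + 1"] by (simp add: \<gamma>_def \<eta>_def)

context
  fixes z :: "nat \<Rightarrow> complex" and K :: "nat \<Rightarrow> nat"
  assumes z: "inj_on z {1..n}" "z ` {1..n} \<subseteq> S" and T: "\<And>l. T l = z ` Jset K n l"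
    and upper: "\<And>l s t. s \<in> Jset K n l \<Longrightarrow> s \<le> t \<Longrightarrow> t \<le> n \<Longrightarrow> t \<in> Jset K n l"
begin

lemma blk_diagonal:
  assumes J: "J \<in> {1..n} \<rightarrow> {1..N}" and l: "l < N"
    and eq: "Jset J n l = Jset K n l" "Jset J n (Suc l) = Jset K n (Suc l)"
    and y: "\<And>s. s \<in> Jset J n l \<Longrightarrow> y s = z s" and w: "\<And>s. s \<in> Jset J n (Suc l) \<Longrightarrow> w s = z s"
  shows "blk l J y w = 1"
  unfolding blk_def
proof (rule prod.neutral, rule ballI)
  fix s assume s: "s \<in> Jset J n l"
  have sub: "Jset J n l \<subseteq> Jset J n (Suc l)" by (auto simp: Jset_iff)
  have sn: "s \<in> {1..n}" "J s \<le> l" using s by (auto simp: Jset_iff)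
  have A: "{s' \<in> Jset J n k. s < s'} = {s<..n}" if "k = l \<or> k = Suc l" for k
    using that s sub upper[of s k] eq by (auto simp: Jset_iff subset_iff)
  have "f (dyn J l s) \<noteq> 0"
    using f_P[of "J s" "Suc l" "- Cnum J n l s"] J sn l by (auto simp: dyn_def Pi_iff)
  then have 1: "\<phi> (w s - y s) (dyn J l s) = 1"
    using y[OF s] w[of s] s sub by (simp add: \<phi>_0 subset_iff)
  have "(\<Prod>s'\<in>{s<..n}. \<gamma> (w s' - y s)) * (\<Prod>s'\<in>{s<..n}. \<eta> (y s - y s')) =
      (\<Prod>s'\<in>{s<..n}. \<gamma> (z s' - z s) * \<eta> (- (z s' - z s)))"
    unfolding prod.distrib[symmetric]
  proof (rule prod.cong[OF refl])
    fix s' assume "s' \<in> {s<..n}"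
    then have "s' \<in> Jset J n l" using A[of l] by blast
    then show "\<gamma> (w s' - y s) * \<eta> (y s - y s') = \<gamma> (z s' - z s) * \<eta> (- (z s' - z s))"
      using y[of s'] w[of s'] y[OF s] sub by (simp add: subset_iff)
  qed
  also have "\<dots> = 1"
  proof (rule prod.neutral, rule ballI)
    fix s' assume s': "s' \<in> {s<..n}"
    then have "z s' \<noteq> z s" "z s \<in> S" "z s' \<in> S"
      using z sn inj_onD[OF z(1), of s' s] by auto
    then show "\<gamma> (z s' - z s) * \<eta> (- (z s' - z s)) = 1"
      using f_S[of "z s'" "z s" 0] f_S_Suc[of "z s'" "z s"] by (intro \<gamma>_mult_\<eta>) auto
  qed
  finally show "fac l J y w s = 1"
    unfolding fac_def 1 using A[of l] A[of "Suc l"] by simp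
qed

text \<open>A nonzero block forces position \<open>s\<close> to carry a value \<open>z (\<kappa>' s)\<close> with \<open>\<kappa>' s \<le> s\<close>; as \<open>Jset K n l\<close> is an
  up-set, the bijection \<open>\<kappa>'\<close> must be the identity.\<close>
lemma blk_triangular:
  assumes y: "y \<in> Bij (Jset J n l) (T l)" and nz: "blk l J y w \<noteq> 0"
    and card: "card (Jset J n l) = card (Jset K n l)"
    and eq: "Jset J n (Suc l) = Jset K n (Suc l)" and w: "\<And>s. s \<in> Jset J n (Suc l) \<Longrightarrow> w s = z s"
  shows "Jset J n l = Jset K n l \<and> y = restrict z (Jset J n l)"
proof -
  let ?A = "Jset J n l" and ?B = "Jset K n l"
  have zB: "inj_on z ?B" by (rule inj_on_subset[OF z(1)]) (auto simp: Jset_iff)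
  have ex: "y \<in> extensional ?A" and yb: "bij_betw y ?A (z ` ?B)" using y by (auto simp: Bij_def T)
  define \<kappa>' where "\<kappa>' = inv_into ?B z \<circ> y"
  have zk: "z (\<kappa>' s) = y s" and kB: "\<kappa>' s \<in> ?B" if "s \<in> ?A" for s
    using bij_betwE[OF yb] that by (auto simp: \<kappa>'_def f_inv_into_f inv_into_into)
  have kb: "bij_betw \<kappa>' ?A ?B"
    using bij_betw_trans[OF yb bij_betw_inv_into[OF inj_on_imp_bij_betw[OF zB]]]
    by (simp add: \<kappa>'_def)
  have le: "\<kappa>' s \<le> s" if s: "s \<in> ?A" for s
  proof (rule ccontr)
    assume "\<not> \<kappa>' s \<le> s"
    moreover have k: "\<kappa>' s \<in> Jset J n (Suc l)" using kB[OF s] by (auto simp: eq Jset_iff)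
    ultimately have m: "\<kappa>' s \<in> {s' \<in> Jset J n (Suc l). s < s'}" by simp
    have "\<gamma> (w (\<kappa>' s) - y s) = 0" using w[OF k] zk[OF s] by (simp add: \<gamma>_def)
    then have "fac l J y w s = 0"
      unfolding fac_def using prod_zero[OF _ bexI[OF _ m], of "\<lambda>s'. \<gamma> (w s' - y s)"] by simp
    then show False using nz s by (auto simp: blk_def)
  qed
  have "?A \<subseteq> ?B"
    using upper[OF kB le] by (auto simp: Jset_iff)
  then have AB: "?A = ?B" using card by (simp add: card_subset_eq)
  have "sum \<kappa>' ?A = sum (\<lambda>s. s) ?A"
    using sum.reindex_bij_betw[OF kb, of "\<lambda>s. s"] AB by simp
  then have "\<kappa>' s = s" if "s \<in> ?A" for s
    using sum_mono_inv[of \<kappa>' ?A "\<lambda>s. s"] le that by simp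
  then have "y s = restrict z ?A s" for s
    using zk[of s] extensional_arb[OF ex, of s] by (cases "s \<in> ?A") auto
  then show ?thesis using AB by auto
qed

lemma G_base:
  assumes J: "J \<in> {1..n} \<rightarrow> {1..N}" and l: "l \<le> N"
    and card: "\<And>k. k \<le> l \<Longrightarrow> card (Jset J n k) = card (Jset K n k)"
    and eq: "Jset J n l = Jset K n l" and w: "\<And>s. s \<in> Jset J n l \<Longrightarrow> w s = z s"
  shows "G l J w = (if \<forall>k\<le>l. Jset J n k = Jset K n k then 1 else 0)"
  using l card eq w
proof (induction l arbitrary: w)
  case (Suc l)
  let ?A = "Jset J n l" and ?y = "restrict z (Jset J n l)"
  have tri: "?A = Jset K n l \<and> y = ?y" if "y \<in> Bij ?A (T l)" "blk l J y w \<noteq> 0" for y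
    by (rule blk_triangular[OF that]) (use Suc.prems in auto)
  show ?case
  proof (cases "?A = Jset K n l")
    case True
    have "bij_betw z ?A (T l)"
      unfolding T True by (intro inj_on_imp_bij_betw inj_on_subset[OF z(1)]) (auto simp: Jset_iff)
    then have "bij_betw ?y ?A (T l)" by (subst bij_betw_cong[of ?A _ z]) auto
    then have y: "?y \<in> Bij ?A (T l)" by (simp add: Bij_def)
    have "G (Suc l) J w = (\<Sum>y\<in>{?y}. blk l J y w * G l J y)"
      unfolding G.simps using y tri by (intro sum.mono_neutral_right finite_Bij) auto
    moreover have "blk l J ?y w = 1"
      by (rule blk_diagonal[OF J]) (use Suc.prems True in auto)
    moreover have "G l J ?y = (if \<forall>k\<le>l. Jset J n k = Jset K n k then 1 else 0)"
      by (rule Suc.IH) (use Suc.prems True in auto)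
    ultimately show ?thesis using Suc.prems(3) by (auto simp: le_Suc_eq)
  next
    case False
    then have "blk l J y w = 0" if "y \<in> Bij ?A (T l)" for y using tri[OF that] by blast
    then have "G (Suc l) J w = 0" by simp
    then show ?thesis using False by auto
  qed
qed simp

end

lemma G_exchange_desc:
  assumes i: "i \<in> {1..<n}" and J: "J \<in> {1..n} \<rightarrow> {1..N}"
    and w: "w i \<in> S" "w (Suc i) \<in> S" "w i \<noteq> w (Suc i)" and gt: "J (Suc i) < J i"
  defines "x \<equiv> w (Suc i) - w i" and "D \<equiv> dpar i J (J (Suc i)) - dpar i J (J i)"
  shows "G N J w = G N J (swp i w) * (f 1 * f (D + x) / (f D * f (x + 1))) +
     G N (swp i J) (swp i w) * (f (D + 1) * f (D - 1) * f x / ((f D)\<^sup>2 * f (x + 1)))"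
proof (rule exchange_inverse)
  have m: "i \<in> {1..n}" "Suc i \<in> {1..n}" using i by auto
  have JN: "J i \<in> {1..N}" "J (Suc i) \<in> {1..N}" using J m by (auto simp: Pi_iff)
  have sJ: "swp i J \<in> {1..n} \<rightarrow> {1..N}" using J JN by (auto simp: swp_apply)
  show "f x \<noteq> 0" "f (x + 1) \<noteq> 0" "f (1 - x) \<noteq> 0"
    unfolding x_def using f_S[of "w (Suc i)" "w i" 0] f_S_Suc[of "w (Suc i)" "w i"] f_S_Suc[of "w i" "w (Suc i)"] w
    by (auto simp: algebra_simps)
  show "f D \<noteq> 0" unfolding D_def using f_dpar[of "J (Suc i)" "J i" i J 0] JN gt by auto
  show "G N (swp i J) w = G N (swp i J) (swp i w) * \<kappa> x D + G N J (swp i w) * \<gamma> x"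
    using G_exchange[OF i sJ order.refl w] gt JN unfolding x_def D_def by simp
  show "G N (swp i J) (swp i w) = G N (swp i J) w * \<kappa> (- x) D + G N J w * \<gamma> (- x)"
    using G_exchange[OF i sJ order.refl, of "swp i w"] w gt JN unfolding x_def D_def by simp
qed

end

section \<open>The recursion for the elliptic bracket\<close>

lemma weierstrass_sigma_brk:
  assumes "Re lq < 0" "r > 0"
  shows "weierstrass_sigma (brk lq r)"
proof
  show "brk lq r (- x) = - brk lq r x" for x by (rule brk_minus[OF assms])
  define A B where "A = theta0 (2 * lq / of_real r) r (1 / 2)" and "B = theta0 (2 * lq / of_real r) r 0"
  note pl = brk_add_mult_brk_diff[OF assms, folded A_def B_def]
  fix a b c d
  show "brk lq r (a + b) * brk lq r (a - b) * (brk lq r (c + d) * brk lq r (c - d))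
      - brk lq r (a + c) * brk lq r (a - c) * (brk lq r (b + d) * brk lq r (b - d))
      + brk lq r (a + d) * brk lq r (a - d) * (brk lq r (b + c) * brk lq r (b - c)) = 0"
    unfolding pl by algebra
qed

lemma lam_eq_card_split:
  assumes J: "J \<in> Iset N n lam" and i: "i \<in> {1..<n}" and ne: "J i \<noteq> J (Suc i)" and c: "c = J i \<or> c = J (Suc i)"
  shows "lam c = card {j \<in> {1..<i}. J j = c} + 1 + cnt n i J c"
proof -
  have "i \<in> {1..n}" "Suc i \<in> {1..n}" using i by auto
  then have "c \<in> {1..N}" using c Iset_range[OF J] by blast
  then have "lam c = card {s \<in> {1..n}. J s = c}" using J by (simp add: Iset_def)
  also have "{s \<in> {1..n}. J s = c} = {j \<in> {1..<i}. J j = c} \<union> ({if J i = c then i else Suc i} \<union> {k \<in> {Suc i<..n}. J k = c})"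
    using i ne c by (auto simp: not_less less_Suc_eq_le le_eq_less_or_eq split: if_splits)
  also have "card \<dots> = card {j \<in> {1..<i}. J j = c} + (1 + card {k \<in> {Suc i<..n}. J k = c})"
    by (subst card_Un_disjoint, simp, simp, force, subst card_Un_disjoint) auto
  finally show ?thesis by (simp add: cnt_def)
qed

lemma Pshift_swp: "Pshift P (swp i J) i = Pshift P J i"
  unfolding Pshift_def by (intro ext arg_cong2[where f = "(+)"] refl arg_cong[where f = of_nat] arg_cong[where f = card])
    (auto simp: swp_apply)

lemma swp_eq_iff: "swp i J = J \<longleftrightarrow> J i = J (Suc i)"
  by (auto simp: swp_apply fun_eq_iff)

lemma sum_Scoef:
  assumes J: "J \<in> seqs N n" "swp i J \<in> seqs N n"
  shows "(\<Sum>mu\<in>seqs N n. F mu * Scoef lq r P i u mu J) =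
    (let x = u i - u (Suc i); D = Pshift P J i (J i) - Pshift P J i (J (Suc i)) in
     if J i = J (Suc i) then F J
     else if J i < J (Suc i) then F J * cbar lq r x D + F (swp i J) * bbar lq r x
     else F J * cw lq r x (- D) + F (swp i J) * bw lq r x (- D))"
proof -
  have fin: "finite (seqs N n)" by (simp add: seqs_def finite_PiE)
  have zero: "Scoef lq r P i u mu J = 0" if "mu \<notin> {J, swp i J}" for mu
  proof -
    have "J \<noteq> mu" "J \<noteq> swp i mu" using that by auto
    then show ?thesis by (simp add: Scoef_def Let_def)
  qed
  have "(\<Sum>mu\<in>seqs N n. F mu * Scoef lq r P i u mu J) = (\<Sum>mu\<in>{J, swp i J}. F mu * Scoef lq r P i u mu J)"
    using J zero by (intro sum.mono_neutral_right fin) auto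
  also have "\<dots> = (let x = u i - u (Suc i); D = Pshift P J i (J i) - Pshift P J i (J (Suc i)) in
     if J i = J (Suc i) then F J
     else if J i < J (Suc i) then F J * cbar lq r x D + F (swp i J) * bbar lq r x
     else F J * cw lq r x (- D) + F (swp i J) * bw lq r x (- D))"
  proof (cases "J i = J (Suc i)")
    case True
    then have "swp i J = J" by (simp add: swp_eq_iff)
    then show ?thesis using True by (simp add: Scoef_def)
  next
    case False
    then have "swp i J \<noteq> J" "J \<noteq> swp i J" using swp_eq_iff by metis+
    then show ?thesis using False by (auto simp: Scoef_def Let_def Pshift_swp)
  qed
  finally show ?thesis .
qed

lemma genu_swp:
  assumes "genu lq r n u" "i \<in> {1..<n}"
  shows "genu lq r n (swp i u)"
  unfolding genu_def
proof (intro ballI impI allI)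
  fix k l and m :: int assume "k \<in> {1..n}" "l \<in> {1..n}" "k \<noteq> l"
  moreover have "swp i u s = u (adj i s)" for s using swp_adj[of i u "adj i s"] by simp
  moreover have "adj i k \<noteq> adj i l" using \<open>k \<noteq> l\<close> by (metis adj_adj)
  ultimately show "brk lq r (swp i u k - swp i u l + of_int m) \<noteq> 0"
    using assms adj_in[OF assms(2)] unfolding genu_def by simp
qed

locale generic_parameters =
  fixes lq :: complex and r :: real and N n :: nat and lam :: "nat \<Rightarrow> nat" and P :: "nat \<Rightarrow> complex"
  assumes lq: "Re lq < 0" and r: "r > 0"
    and gen_r: "m \<noteq> 0 \<Longrightarrow> brk lq r (of_int m) \<noteq> 0"
    and gen_P: "a \<in> {1..N} \<Longrightarrow> b \<in> {1..N} \<Longrightarrow> a \<noteq> b \<Longrightarrow> brk lq r (P a - P b + of_int m) \<noteq> 0"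
begin

definition P' :: "nat \<Rightarrow> complex" where "P' a = P a + of_nat (lam a)"

definition levels :: "(nat \<Rightarrow> nat) \<Rightarrow> (nat \<Rightarrow> complex) \<Rightarrow> nat \<Rightarrow> complex set" where
  "levels K u l = (\<lambda>i. - u i) ` Jset K n l"

definition X :: "(nat \<Rightarrow> nat) \<Rightarrow> (nat \<Rightarrow> complex) \<Rightarrow> (nat \<Rightarrow> nat) \<Rightarrow> complex" where
  "X K u J = weight_function.G (brk lq r) n P' (levels K u) N J (\<lambda>a. - u a)"

lemma weight_function_brk:
  assumes u: "genu lq r n u"
  shows "weight_function (brk lq r) N P' (levels K u) ((\<lambda>i. - u i) ` {1..n})"
proof -
  interpret weierstrass_sigma "brk lq r" by (rule weierstrass_sigma_brk[OF lq r])
  show ?thesis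
  proof unfold_locales
    show "m \<noteq> 0 \<Longrightarrow> brk lq r (of_int m) \<noteq> 0" for m by (rule gen_r)
    show "brk lq r (P' a - P' b + of_int m) \<noteq> 0" if "a \<in> {1..N}" "b \<in> {1..N}" "a \<noteq> b" for a b m
    proof -
      have "P' a - P' b + of_int m = P a - P b + of_int (m + int (lam a) - int (lam b))"
        by (simp add: P'_def)
      then show ?thesis using gen_P[OF that] by metis
    qed
    show "brk lq r (s - t + of_int m) \<noteq> 0"
      if "s \<in> (\<lambda>i. - u i) ` {1..n}" "t \<in> (\<lambda>i. - u i) ` {1..n}" "s \<noteq> t" for s t m
    proof -
      from that obtain k l where "s = - u k" "t = - u l" "k \<in> {1..n}" "l \<in> {1..n}" "k \<noteq> l" by blast
      then show ?thesis using u unfolding genu_def by (simp add: add.commute)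
    qed
    show "levels K u l \<subseteq> (\<lambda>i. - u i) ` {1..n}" for l
      by (auto simp: levels_def Jset_iff)
  qed
qed

lemma genu_inj:
  assumes "genu lq r n u"
  shows "inj_on (\<lambda>i. - u i) {1..n}"
proof (rule inj_onI)
  interpret weierstrass_sigma "brk lq r" by (rule weierstrass_sigma_brk[OF lq r])
  fix k l assume kl: "k \<in> {1..n}" "l \<in> {1..n}" "- u k = - u l"
  then have "brk lq r (u k - u l + of_int 0) = 0" by simp
  then show "k = l" using assms kl(1,2) unfolding genu_def by blast
qed

lemma levels_swp:
  assumes "i \<in> {1..<n}"
  shows "levels (swp i K) (swp i u) = levels K u"
  unfolding levels_def Jset_swp[OF assms] image_image swp_adj ..

lemma X_exchange:
  assumes J: "J \<in> Iset N n lam" and i: "i \<in> {1..<n}" and u: "genu lq r n u"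
  shows "X (swp i K) u J = (\<Sum>mu\<in>seqs N n. X K (swp i u) mu * Scoef lq r P i u mu J)"
proof -
  interpret weight_function "brk lq r" N n P' "levels (swp i K) u" "(\<lambda>i. - u i) ` {1..n}"
    by (rule weight_function_brk[OF u])
  have i': "i \<in> {1..n}" "Suc i \<in> {1..n}" using i by auto
  define w where "w a = - u a" for a
  have G: "X (swp i K) u M = G N M w" for M by (simp add: X_def w_def[abs_def])
  have "levels K (swp i u) = levels (swp i K) u" using levels_swp[OF i, of K "swp i u"] by simp
  moreover have "(\<lambda>a. - swp i u a) = swp i w" by (simp add: w_def swp_apply fun_eq_iff)
  ultimately have Gs: "X K (swp i u) M = G N M (swp i w)" for M by (simp add: X_def)
  have JN: "J \<in> {1..n} \<rightarrow> {1..N}" using J by (auto simp: Iset_def seqs_def)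
  have seqs: "J \<in> seqs N n" "swp i J \<in> seqs N n" using J swp_Iset[OF J i] by (simp_all add: Iset_def)
  have w: "w i \<in> (\<lambda>i. - u i) ` {1..n}" "w (Suc i) \<in> (\<lambda>i. - u i) ` {1..n}" "w i \<noteq> w (Suc i)"
    using i' inj_onD[OF genu_inj[OF u], of i "Suc i"] by (auto simp: w_def)
  have x: "w (Suc i) - w i = u i - u (Suc i)" by (simp add: w_def)
  have Jle: "J i \<le> N" "J (Suc i) \<le> N" using Iset_range[OF J] i' by auto
  have dpar: "dpar i J c = Pshift P J i c + 1" if "J i \<noteq> J (Suc i)" "c = J i \<or> c = J (Suc i)" for c
    using lam_eq_card_split[OF J i that] by (simp add: dpar_def P'_def Pshift_def)
  note exch = G_exchange[OF i JN order.refl w]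
  consider "J i = J (Suc i)" | "J i < J (Suc i)" | "J (Suc i) < J i" by linarith
  then show ?thesis
  proof cases
    case 1
    then have "G N J (swp i w) = G N J w" using exch Jle by blast
    then show ?thesis unfolding G Gs sum_Scoef[OF seqs] using 1 by simp
  next
    case 2
    then have D: "dpar i J (J i) - dpar i J (J (Suc i)) = Pshift P J i (J i) - Pshift P J i (J (Suc i))"
      by (simp add: dpar)
    show ?thesis unfolding G Gs sum_Scoef[OF seqs]
      using 2 exch Jle unfolding x D by (simp add: Let_def \<kappa>_def \<gamma>_def cbar_def bbar_def)
  next
    case 3
    define D where "D = Pshift P J i (J i) - Pshift P J i (J (Suc i))"
    have D': "dpar i J (J (Suc i)) - dpar i J (J i) = - D"
      using 3 by (simp add: dpar D_def)
    show ?thesis unfolding G Gs sum_Scoef[OF seqs] D_def[symmetric]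
      using 3 G_exchange_desc[OF i JN w 3] unfolding x D' by (simp add: Let_def cw_def bw_def)
  qed
qed

lemma X_antitone:
  assumes J: "J \<in> Iset N n lam" and K: "K \<in> Iset N n lam" and u: "genu lq r n u"
    and anti: "\<And>i. i \<in> {1..<n} \<Longrightarrow> K (Suc i) \<le> K i"
  shows "X K u J = (if J = K then 1 else 0)"
proof -
  interpret weight_function "brk lq r" N n P' "levels K u" "(\<lambda>i. - u i) ` {1..n}"
    by (rule weight_function_brk[OF u])
  have JN: "J \<in> {1..n} \<rightarrow> {1..N}" using J by (auto simp: Iset_def seqs_def)
  have top: "Jset M n N = {1..n}" if "M \<in> Iset N n lam" for M
    using Iset_range[OF that] by (fastforce simp: Jset_def)
  have "G N J (\<lambda>a. - u a) = (if \<forall>k\<le>N. Jset J n k = Jset K n k then 1 else 0)"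
  proof (rule G_base[OF genu_inj[OF u] _ _ _ JN])
    show "t \<in> Jset K n l" if "s \<in> Jset K n l" "s \<le> t" "t \<le> n" for l s t
      using that antitone_adjacent[of n K s t] anti by (force simp: Jset_iff)
  qed (use top J K in \<open>auto simp: levels_def card_Jset\<close>)
  also have "(\<forall>k\<le>N. Jset J n k = Jset K n k) \<longleftrightarrow> J = K"
    using Iset_eqI[OF J K] by blast
  finally show ?thesis by (simp add: X_def)
qed

lemma X_eq_Wtilde:
  assumes I: "I \<in> Iset N n lam" and J: "J \<in> Iset N n lam" and u: "genu lq r n u" and N: "N \<ge> 1"
  shows "X I u J = Wtilde lq r N n lam J (\<lambda>l a. if l = N then - u a else - u (jidx I n l a)) P'"
proof -
  interpret weight_function "brk lq r" N n P' "levels I u" "(\<lambda>i. - u i) ` {1..n}"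
    by (rule weight_function_brk[OF u])
  define v where "v l a = (if l = N then - u a else - u (jidx I n l a))" for l a
  have top: "Jset J n N = {1..n}"
    using Iset_range[OF J] by (fastforce simp: Jset_def)
  have jN: "jidx J n N b = b" if "b \<in> {1..n}" for b
  proof -
    have "sorted_list_of_set {1..n} = [1..<Suc n]"
      by (metis atLeastLessThanSuc_atLeastAtMost sorted_list_of_set_range)
    then show ?thesis using that unfolding jidx_def top by (simp del: upt_Suc)
  qed
  have "X I u J = G (Suc (N - 1)) J (\<lambda>a. - u a)" using N by (simp add: X_def)
  also have "\<dots> = (\<Sum>\<sigma>\<in>(\<Pi>\<^sub>E l\<in>{1..N - 1}. {\<pi>. \<pi> permutes {1..lamc lam l}}). \<Prod>l\<in>{1..N - 1}.
      blk_idx l (lamc lam) J (\<lambda>a. v l (\<sigma> l a)) (if l = N - 1 then v N else (\<lambda>a. v (Suc l) (\<sigma> (Suc l) a))))"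
  proof (rule sum_PiE_chain_eq_G[symmetric, where M = N])
    have "1 \<le> J s" "1 \<le> I s" if "s \<in> {1..n}" for s using Iset_range[OF J that] Iset_range[OF I that] by auto
    then show "Jset J n 0 = {}" "levels I u 0 = {}" by (fastforce simp: Jset_def levels_def)+
    show "lamc lam l = card (Jset J n l)" if "l \<le> N" for l using card_Jset[OF J that] by simp
    show "bij_betw (v l) {1..lamc lam l} (levels I u l)" if l: "l \<in> {1..<N}" for l
    proof -
      have c: "card (Jset I n l) = lamc lam l" using card_Jset[OF I] l by simp
      have "inj_on (\<lambda>i. - u i) (Jset I n l)"
        using genu_inj[OF u] by (rule inj_on_subset) (auto simp: Jset_iff)
      then have "bij_betw ((\<lambda>i. - u i) \<circ> jidx I n l) {1..lamc lam l} (levels I u l)"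
        unfolding levels_def using bij_betw_trans[OF bij_betw_jidx[of I n l] inj_on_imp_bij_betw] c by simp
      moreover have "v l = (\<lambda>i. - u i) \<circ> jidx I n l" using l by (simp add: v_def fun_eq_iff)
      ultimately show ?thesis by simp
    qed
    show "- u (jidx J n (Suc (N - 1)) b) = v N b" if "b \<in> {1..lamc lam (Suc (N - 1))}" for b
    proof -
      have "lamc lam N = n" using card_Jset[OF J order.refl] top by simp
      then show ?thesis using that N jN[of b] by (simp add: v_def)
    qed
  qed (use N in auto)
  also have "\<dots> = Wtilde lq r N n lam J v P'"
    unfolding Wtilde_def Utilde_def
  proof (intro sum.cong refl prod.cong, goal_cases)
    case l: (1 \<sigma> l)
    have v1: "(\<lambda>a. if l \<in> {1..N - 1} then v l (\<sigma> l a) else v l a) = (\<lambda>a. v l (\<sigma> l a))"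
      using l(2) by (simp add: fun_eq_iff)
    have v2: "(\<lambda>a. if Suc l \<in> {1..N - 1} then v (Suc l) (\<sigma> (Suc l) a) else v (Suc l) a) =
        (if l = N - 1 then v N else (\<lambda>a. v (Suc l) (\<sigma> (Suc l) a)))"
      using l(2) N by (auto simp: fun_eq_iff)
    show ?case
      unfolding fun_cong[OF v1] fun_cong[OF v2] blk_idx_def ..
  qed
  finally show ?thesis by (simp add: v_def[abs_def])
qed

end

theorem theorem4p5:
  fixes q lq :: complex and r :: real and N n :: nat and lam :: "nat \<Rightarrow> nat"
    and P u :: "nat \<Rightarrow> complex"
    and xi :: "(nat \<Rightarrow> nat) \<Rightarrow> (nat \<Rightarrow> complex) \<Rightarrow> (nat \<Rightarrow> nat) \<Rightarrow> complex"
    and I J :: "nat \<Rightarrow> nat"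
  assumes N2: "N \<ge> 2" and n1: "n \<ge> 1"
    and q_def: "q = exp lq" and q_pos: "0 < norm q" and q_lt1: "norm q < 1"
    and r_pos: "r > 0"
    and lam_sum: "(\<Sum>l\<in>{1..N}. lam l) = n"
    and gen_r: "\<forall>m::int. m \<noteq> 0 \<longrightarrow> brk lq r (of_int m) \<noteq> 0"
    and gen_P: "\<forall>a\<in>{1..N}. \<forall>b\<in>{1..N}. a \<noteq> b \<longrightarrow>
                  (\<forall>m::int. brk lq r (P a - P b + of_int m) \<noteq> 0)"
    and gen_u: "genu lq r n u"
    and xi_max: "\<forall>w. xi (Imax N n lam) w = (\<lambda>K. if K = Imax N n lam then 1 else 0)"
    and xi_rec: "\<forall>K\<in>Iset N n lam. \<forall>i\<in>{1..<n}. \<forall>w. genu lq r n w \<longrightarrow>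
                  xi (swp i K) w = St lq r P N n i (xi K) w"
    and I_in: "I \<in> Iset N n lam" and J_in: "J \<in> Iset N n lam"
  shows "xi I u J =
    Wtilde lq r N n lam J (\<lambda>l a. if l = N then - u a else - u (jidx I n l a))
      (\<lambda>a. P a + of_nat (lam a))"
proof -
  have lq: "Re lq < 0" using q_lt1 by (simp add: q_def)
  interpret generic_parameters lq r N n lam P
    by unfold_locales (use lq r_pos gen_r gen_P in auto)
  have "xi K w M = X K w M" if "K \<in> Iset N n lam" "M \<in> Iset N n lam" "genu lq r n w" for K M w
    using that
  proof (induction "\<Sum>s\<in>{1..n}. s * K s" arbitrary: K M w rule: less_induct)
    case less
    show ?case
    proof (cases "\<exists>i\<in>{1..<n}. K i < K (Suc i)")
      case True
      then obtain i where i: "i \<in> {1..<n}" "K i < K (Suc i)" by blast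
      let ?K = "swp i K"
      have K: "?K \<in> Iset N n lam" by (rule swp_Iset[OF less.prems(1) i(1)])
      have w: "genu lq r n (swp i w)" by (rule genu_swp[OF less.prems(3) i(1)])
      have m: "(\<Sum>s\<in>{1..n}. s * ?K s) < (\<Sum>s\<in>{1..n}. s * K s)"
      proof -
        have mem: "i \<in> {1..n}" "Suc i \<in> {1..n} - {i}" using i(1) by auto
        have split: "(\<Sum>s\<in>{1..n}. s * L s) = i * L i + (Suc i * L (Suc i) + (\<Sum>s\<in>{1..n} - {i} - {Suc i}. s * L s))" for L
          unfolding sum.remove[OF finite_atLeastAtMost mem(1)] sum.remove[OF finite_Diff[OF finite_atLeastAtMost] mem(2)] ..
        have "(\<Sum>s\<in>{1..n} - {i} - {Suc i}. s * ?K s) = (\<Sum>s\<in>{1..n} - {i} - {Suc i}. s * K s)"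
          by (intro sum.cong) (auto simp: swp_apply)
        then show ?thesis unfolding split[of ?K] split[of K] using i(2) by simp
      qed
      have "xi K w M = xi (swp i ?K) w M" by simp
      also have "\<dots> = (\<Sum>mu\<in>seqs N n. xi ?K (swp i w) mu * Scoef lq r P i w mu M)"
        using xi_rec K i(1) less.prems(3) by (simp add: St_def del: swp_swp)
      also have "\<dots> = (\<Sum>mu\<in>seqs N n. X ?K (swp i w) mu * Scoef lq r P i w mu M)"
      proof -
        have "xi ?K (swp i w) M = X ?K (swp i w) M" "xi ?K (swp i w) (swp i M) = X ?K (swp i w) (swp i M)"
          using less.hyps[OF m K _ w] less.prems(2) swp_Iset[OF less.prems(2) i(1)] by blast+
        moreover have "M \<in> seqs N n" "swp i M \<in> seqs N n"
          using less.prems(2) swp_Iset[OF less.prems(2) i(1)] by (simp_all add: Iset_def)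
        ultimately show ?thesis by (simp only: sum_Scoef)
      qed
      also have "\<dots> = X (swp i ?K) w M"
        by (rule X_exchange[OF less.prems(2) i(1) less.prems(3), symmetric])
      finally show ?thesis by simp
    next
      case False
      then have anti: "K (Suc i) \<le> K i" if "i \<in> {1..<n}" for i using that by (meson not_le)
      then show ?thesis
        using xi_max antitone_eq_Imax[OF less.prems(1) anti] X_antitone[OF less.prems(2,1,3) anti] by simp
    qed
  qed
  then have "xi I u J = X I u J" using I_in J_in gen_u by blast
  also have "\<dots> = Wtilde lq r N n lam J (\<lambda>l a. if l = N then - u a else - u (jidx I n l a)) P'"
    by (rule X_eq_Wtilde[OF I_in J_in gen_u]) (use N2 in simp)
  finally show ?thesis by (simp add: P'_def[abs_def])
qed

end
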